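(* Let $1\leq k<d$ be integers, let $G=(V,E)$ be a finite simple graph and let $(G,p)$ be a generic framework in $\mathbb{R}^d$. If there exists $\sigma\in\ker DR_k(G,p)^T$ such that $\operatorname{rank}\Omega(\sigma)=|V|-d+k-1$, then $(G,p)$ is globally $(d,k)$-rigid.
   Context: Generic: the coordinates of the points $p(v)$ are distinct and algebraically independent over $\mathbb{Q}$. $p_i$ is the $i$-th coordinate of $p$ and $\tilde p=(p_1,\ldots,p_{d-k}):V\to\mathbb{R}^{d-k}$. For $x:V\to\mathbb{R}^m$, $R(G,x)$ is the $|E|\times m|V|$ rigidity matrix (row $vw$ has $x(v)-x(w)$ in the columns of $v$, $x(w)-x(v)$ in those of $w$, zeros elsewhere). For $y:V\to\mathbb{R}$, $f_{G,1}(y)\in\mathbb{R}^E$ has entries $(y(v)-y(w))^2$. $DR_k(G,p)=[\,R(G,\tilde p)\ \ f_{G,1}(p_{d-k+1})\ \cdots\ f_{G,1}(p_d)\,]$. For $\sigma\in\mathbb{R}^E$, the stress matrix $\Omega(\sigma)$ is the $|V|\times|V|$ symmetric matrix with off-diagonal entry $-\sigma(vw)$ in position $(v,w)$ (zero if $vw\notin E$) and diagonal entry $\sum_{w}\sigma(vw)$ in position $(v,v)$, i.e. the Laplacian of the weighted graph $(G,\sigma)$. Frameworks $(G,p),(G,q)$ in $\mathbb{R}^d$ are $(d,k)$-equivalent if $\|p(v)-p(w)\|=\|q(v)-q(w)\|$ for all $vw\in E$ and for each $i\in\{d-k+1,\ldots,d\}$ there is a scalar $\alpha_i\neq0$ with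 $p_i=\alpha_i q_i$. $(G,p)$ is globally $(d,k)$-rigid if every framework $(G,q)$ in $\mathbb{R}^d$ that is $(d,k)$-equivalent to $(G,p)$ is congruent to it, i.e. $\|q(v)-q(w)\|=\|p(v)-p(w)\|$ for all $v,w\in V$.
   Formalization: Adds the hypothesis that G is complete when |V| = d-k+1; there the required rank is 0, so σ = 0 qualifies for every graph and the claim fails for every non-complete G (e.g. d=2, k=1, two vertices, no edges). *)

theory Defs
  imports "HOL-Analysis.Analysis" "HOL-Library.Poly_Mapping"
begin

(* A graph has the finite type 'v as vertex set and a set E of two-element sets as edge set.
   R^d is real^('m + 'k): the indices Inl _ are the first d - k = CARD('m) coordinates,
   the indices Inr _ are the last k = CARD('k) coordinates. *)

definition simple_graph :: "'v set set \<Rightarrow> bool" where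
  "simple_graph E \<longleftrightarrow> (\<forall>e\<in>E. \<exists>v w. v \<noteq> w \<and> e = {v, w})"

definition complete_graph :: "'v set set \<Rightarrow> bool" where
  "complete_graph E \<longleftrightarrow> (\<forall>v w. v \<noteq> w \<longrightarrow> {v, w} \<in> E)"

(* Value at x of a multivariate polynomial with rational coefficients; the elements of
   'i \<Rightarrow>\<^sub>0 nat are the exponent vectors of the monomials. *)
definition eval_mpoly :: "(('i \<Rightarrow>\<^sub>0 nat) \<Rightarrow>\<^sub>0 rat) \<Rightarrow> ('i \<Rightarrow> real) \<Rightarrow> real" where
  "eval_mpoly P x =
     (\<Sum>m\<in>Poly_Mapping.keys P. of_rat (Poly_Mapping.lookup P m) *
        (\<Prod>i\<in>Poly_Mapping.keys m. x i ^ Poly_Mapping.lookup m i))"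

definition alg_independent_rat :: "('i \<Rightarrow> real) \<Rightarrow> bool" where
  "alg_independent_rat x \<longleftrightarrow> (\<forall>P. eval_mpoly P x = 0 \<longrightarrow> P = 0)"

definition generic :: "('v \<Rightarrow> real^'n) \<Rightarrow> bool" where
  "generic p \<longleftrightarrow> inj (\<lambda>(v, i). p v $ i) \<and> alg_independent_rat (\<lambda>(v, i). p v $ i)"

definition first_coords :: "('v \<Rightarrow> real^('m::finite + 'k::finite)) \<Rightarrow> 'v \<Rightarrow> real^'m" where
  "first_coords p v = (\<chi> i. p v $ Inl i)"

(* Matrices whose rows are indexed by the edges are functions of a row and a column index; only
   the rows in E matter. For e = {v, w} the sum below is x v $ i - x w $ i, since the summand
   belonging to v itself vanishes. *)
definition rigidity_matrix :: "('v \<Rightarrow> real^'m) \<Rightarrow> 'v set \<Rightarrow> 'v \<times> 'm \<Rightarrow> real" where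
  "rigidity_matrix x e = (\<lambda>(v, i). if v \<in> e then (\<Sum>w\<in>e. x v $ i - x w $ i) else 0)"

definition edge_map :: "('v \<Rightarrow> real) \<Rightarrow> 'v set \<Rightarrow> real" where
  "edge_map y e = (THE r. \<exists>v w. e = {v, w} \<and> r = (y v - y w)\<^sup>2)"

definition DR_matrix ::
  "('v \<Rightarrow> real^('m::finite + 'k::finite)) \<Rightarrow> 'v set \<Rightarrow> 'v \<times> 'm + 'k \<Rightarrow> real" where
  "DR_matrix p e = case_sum (rigidity_matrix (first_coords p) e) (\<lambda>i. edge_map (\<lambda>v. p v $ Inr i) e)"

(* The kernel of the transpose of the matrix M with row index set E. Vectors in R^E are functions
   on all sets of vertices whose values outside E are never used. *)
definition ker_transpose :: "'v set set \<Rightarrow> ('v set \<Rightarrow> 'c \<Rightarrow> real) \<Rightarrow> ('v set \<Rightarrow> real) set" where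
  "ker_transpose E M = {\<sigma>. \<forall>j. (\<Sum>e\<in>E. M e j * \<sigma> e) = 0}"

definition stress_matrix :: "'v set set \<Rightarrow> ('v set \<Rightarrow> real) \<Rightarrow> real^'v::finite^'v" where
  "stress_matrix E \<sigma> = (\<chi> v w.
     if v = w then (\<Sum>u | {v, u} \<in> E. \<sigma> {v, u})
     else if {v, w} \<in> E then - \<sigma> {v, w} else 0)"

definition dk_equivalent ::
  "'v set set \<Rightarrow> ('v \<Rightarrow> real^('m::finite + 'k::finite)) \<Rightarrow> ('v \<Rightarrow> real^('m + 'k)) \<Rightarrow> bool" where
  "dk_equivalent E p q \<longleftrightarrow>
     (\<forall>v w. {v, w} \<in> E \<longrightarrow> norm (p v - p w) = norm (q v - q w)) \<and>
     (\<forall>i::'k. \<exists>\<alpha>. \<alpha> \<noteq> 0 \<and> (\<forall>v. p v $ Inr i = \<alpha> * q v $ Inr i))"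

definition congruent_frameworks :: "('v \<Rightarrow> real^'n) \<Rightarrow> ('v \<Rightarrow> real^'n) \<Rightarrow> bool" where
  "congruent_frameworks p q \<longleftrightarrow> (\<forall>v w. norm (q v - q w) = norm (p v - p w))"

definition globally_dk_rigid :: "'v set set \<Rightarrow> ('v \<Rightarrow> real^('m::finite + 'k::finite)) \<Rightarrow> bool" where
  "globally_dk_rigid E p \<longleftrightarrow> (\<forall>q. dk_equivalent E p q \<longrightarrow> congruent_frameworks p q)"

lemma rigidity_matrix_entries:
  assumes "v \<noteq> w"
  shows "rigidity_matrix x {v, w} (v, i) = x v $ i - x w $ i"
    and "rigidity_matrix x {v, w} (w, i) = x w $ i - x v $ i"
    and "u \<notin> {v, w} \<Longrightarrow> rigidity_matrix x {v, w} (u, i) = 0"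
  using assms by (auto simp: rigidity_matrix_def)

lemma edge_map_entries: "edge_map y {v, w} = (y v - y w)\<^sup>2"
  unfolding edge_map_def by (rule the_equality) (auto simp: doubleton_eq_iff power2_commute)

(* The next two lemmas concern graphs with exactly d - k + 1 vertices. There the required rank is 0,
   so the zero stress satisfies the hypothesis for every graph, whereas the graph without edges is
   not globally rigid. Hence the rank condition alone does not suffice for d - k + 1 vertices, and
   in that single case the theorem needs completeness of the graph. *)
lemma zero_stress:
  "(\<lambda>_. 0) \<in> ker_transpose E (DR_matrix p)" "rank (stress_matrix E (\<lambda>_. 0)) = 0"
proof -
  have "stress_matrix E (\<lambda>_. 0) = 0"
    by (simp add: stress_matrix_def vec_eq_iff)
  then show "rank (stress_matrix E (\<lambda>_. 0)) = 0" by (simp only: rank_0)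
qed (simp add: ker_transpose_def)

lemma not_globally_dk_rigid_no_edges:
  fixes p :: "'v::finite \<Rightarrow> real^('m::finite + 'k::finite)"
  assumes "2 \<le> CARD('v)"
  shows "\<not> globally_dk_rigid {} p"
proof
  assume rigid: "globally_dk_rigid {} p"
  obtain v w :: 'v where vw: "v \<noteq> w"
    using assms ex_card[of 2 "UNIV :: 'v set"] by (auto simp: card_2_iff)
  define b :: "real^('m + 'k)" where "b = axis (Inl undefined) 1"
  define t where "t = 1 + 2 * \<bar>(p v - p w) \<bullet> b\<bar>"
  define q where "q = p(v := p v + t *\<^sub>R b)"
  have b: "b $ Inr i = 0" "b \<bullet> b = 1" for i
    unfolding b_def by (simp add: axis_def, simp add: inner_axis_axis)
  have "dk_equivalent {} p q"
    unfolding dk_equivalent_def by (auto simp: q_def b intro!: exI[of _ 1])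
  with rigid have "norm (q v - q w) = norm (p v - p w)"
    by (auto simp: globally_dk_rigid_def congruent_frameworks_def)
  moreover have "q v - q w = (p v - p w) + t *\<^sub>R b"
    using vw by (simp add: q_def)
  ultimately have "(p v - p w + t *\<^sub>R b) \<bullet> (p v - p w + t *\<^sub>R b) = (p v - p w) \<bullet> (p v - p w)"
    by (simp add: norm_eq)
  moreover have "(a + t *\<^sub>R b) \<bullet> (a + t *\<^sub>R b) = a \<bullet> a + t * (2 * (a \<bullet> b) + t)" for a
    using b by (simp add: inner_add_left inner_add_right inner_commute algebra_simps)
  ultimately have "t * (2 * ((p v - p w) \<bullet> b) + t) = 0" by simp
  then show False by (auto simp: t_def abs_if split: if_splits)
qed

end

theory Submission
  imports Defs "HOL-Computational_Algebra.Polynomial"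
begin

text \<open>Let \<open>q\<close> be equivalent to the generic framework \<open>p\<close>, and let \<open>s\<close> be the given stress. The proof is an
  algebraic version of Connelly's argument for ordinary global rigidity, with derivations of the field of
  real numbers in place of differential topology.

  An algebraic relation over the rationals between values of polynomials at the generic point \<open>p\<close> is an
  identity. So if a polynomial map \<open>H\<close> takes the same value at \<open>p\<close> and at \<open>q\<close>, then for every direction \<open>w\<close>
  sending \<open>H p\<close> to the derivative of \<open>H\<close> at \<open>q\<close> in direction \<open>w\<close> is a well-defined derivation on the ring
  generated by \<open>H p\<close>. It extends to a derivation \<open>D\<close> of the real numbers, and computing \<open>D (H p)\<close> by the
  chain rule shows that this directional derivative lies in the image of the derivative of \<open>H\<close> at \<open>p\<close>.
  Hence \<open>s\<close> is also an equilibrium stress for the first coordinates of \<open>q\<close>, and by the rank condition these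
  are an affine image of the first coordinates of \<open>p\<close>.

  Comparing edge lengths, a quadratic form in the first coordinates of the edge vectors of \<open>p\<close> equals a
  linear combination of the squares of the last ones. Applying derivations to the equations that define \<open>s\<close>
  shows that the linear combination is trivial, and the quadratic form vanishes because the edge directions
  of a generic framework of sufficiently large minimum degree lie on no quadric.\<close>

section \<open>Rational polynomial functions\<close>

definition monomial :: "('i \<Rightarrow>\<^sub>0 nat) \<Rightarrow> ('i \<Rightarrow> real) \<Rightarrow> real" where
  "monomial m x = (\<Prod>i\<in>Poly_Mapping.keys m. x i ^ Poly_Mapping.lookup m i)"

lemma monomial_superset:
  assumes "finite A" "Poly_Mapping.keys m \<subseteq> A"
  shows "monomial m x = (\<Prod>i\<in>A. x i ^ Poly_Mapping.lookup m i)"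
  unfolding monomial_def
  by (rule prod.mono_neutral_left) (use assms in \<open>auto simp: in_keys_iff\<close>)

lemma monomial_add: "monomial (m + n) x = monomial m x * monomial n x"
proof -
  let ?A = "Poly_Mapping.keys m \<union> Poly_Mapping.keys n"
  have "monomial k x = (\<Prod>i\<in>?A. x i ^ Poly_Mapping.lookup k i)" if "k \<in> {m, n, m + n}" for k
    by (rule monomial_superset) (use that keys_add[of m n] in auto)
  then show ?thesis
    by (simp add: lookup_add power_add prod.distrib)
qed

lemma eval_mpoly_superset:
  assumes "finite A" "Poly_Mapping.keys P \<subseteq> A"
  shows "eval_mpoly P x = (\<Sum>m\<in>A. of_rat (Poly_Mapping.lookup P m) * monomial m x)"
  unfolding eval_mpoly_def monomial_def
  by (rule sum.mono_neutral_left) (use assms in \<open>auto simp: in_keys_iff\<close>)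

lemma eval_mpoly_add: "eval_mpoly (P + Q) x = eval_mpoly P x + eval_mpoly Q x"
proof -
  let ?A = "Poly_Mapping.keys P \<union> Poly_Mapping.keys Q"
  have "eval_mpoly R x = (\<Sum>m\<in>?A. of_rat (Poly_Mapping.lookup R m) * monomial m x)"
    if "R \<in> {P, Q, P + Q}" for R
    by (rule eval_mpoly_superset) (use that keys_add[of P Q] in auto)
  then show ?thesis
    by (simp add: lookup_add of_rat_add distrib_right sum.distrib)
qed

lemma eval_mpoly_single: "eval_mpoly (Poly_Mapping.single m c) x = of_rat c * monomial m x"
  by (subst eval_mpoly_superset[of "{m}"]) auto

lemma poly_mapping_single_induct [case_names zero single_add]:
  assumes "Q 0" and "\<And>m c P. Q P \<Longrightarrow> Q (Poly_Mapping.single m c + P)"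
  shows "Q (P :: 'a \<Rightarrow>\<^sub>0 'b::comm_monoid_add)"
proof (induction P rule: update_induct)
  case const
  show ?case by (rule assms(1))
next
  case (update f a b)
  have "Poly_Mapping.update a b f = Poly_Mapping.single a b + f"
    using update(1) by (intro poly_mapping_eqI) (auto simp: lookup_update lookup_add lookup_single when_def in_keys_iff)
  with assms(2)[OF update(3), of a b] show ?case by simp
qed

text \<open>By additivity in each factor, splitting off one term at a time reduces the claim to
  products of two monomials.\<close>

lemma eval_mpoly_mult: "eval_mpoly (P * Q) x = eval_mpoly P x * eval_mpoly Q x"
proof (induction P rule: poly_mapping_single_induct)
  case zero
  show ?case by (simp add: eval_mpoly_def)
next
  case (single_add m c P)
  have "eval_mpoly (Poly_Mapping.single m c * Q) x = of_rat c * monomial m x * eval_mpoly Q x"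
  proof (induction Q rule: poly_mapping_single_induct)
    case zero
    show ?case by (simp add: eval_mpoly_def)
  next
    case (single_add n b Q)
    then show ?case
      by (simp add: distrib_left eval_mpoly_add mult_single eval_mpoly_single monomial_add of_rat_mult)
  qed
  with single_add show ?case
    by (simp add: distrib_right eval_mpoly_add eval_mpoly_single)
qed


text \<open>Polynomial functions are generated inductively, so that polynomiality of determinants
  and squared lengths follows from closure rules, without writing down an element of the polynomial
  ring.\<close>

inductive ratpoly :: "(('i \<Rightarrow> real) \<Rightarrow> real) \<Rightarrow> bool" where
  ratpoly_const: "ratpoly (\<lambda>_. of_rat c)"
| ratpoly_var: "ratpoly (\<lambda>x. x i)"
| ratpoly_add: "ratpoly F \<Longrightarrow> ratpoly G \<Longrightarrow> ratpoly (\<lambda>x. F x + G x)"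
| ratpoly_mult: "ratpoly F \<Longrightarrow> ratpoly G \<Longrightarrow> ratpoly (\<lambda>x. F x * G x)"

lemma ratpoly_0: "ratpoly (\<lambda>_. 0)"
  using ratpoly_const[of 0] by simp

lemma ratpoly_1: "ratpoly (\<lambda>_. 1)"
  using ratpoly_const[of 1] by simp

lemma ratpoly_uminus: "ratpoly F \<Longrightarrow> ratpoly (\<lambda>x. - F x)"
  using ratpoly_mult[OF ratpoly_const[of "- 1"]] by simp

lemma ratpoly_diff: "ratpoly F \<Longrightarrow> ratpoly G \<Longrightarrow> ratpoly (\<lambda>x. F x - G x)"
  using ratpoly_add[OF _ ratpoly_uminus] by simp

lemma ratpoly_power: "ratpoly F \<Longrightarrow> ratpoly (\<lambda>x. F x ^ n)"
  by (induction n) (auto intro: ratpoly_1 ratpoly_mult)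

lemma ratpoly_sum: "(\<And>a. a \<in> A \<Longrightarrow> ratpoly (F a)) \<Longrightarrow> ratpoly (\<lambda>x. \<Sum>a\<in>A. F a x)"
  by (induction A rule: infinite_finite_induct) (auto intro: ratpoly_0 ratpoly_add)

lemma ratpoly_prod: "(\<And>a. a \<in> A \<Longrightarrow> ratpoly (F a)) \<Longrightarrow> ratpoly (\<lambda>x. \<Prod>a\<in>A. F a x)"
  by (induction A rule: infinite_finite_induct) (auto intro: ratpoly_1 ratpoly_mult)

lemma ratpoly_if: "ratpoly F \<Longrightarrow> ratpoly G \<Longrightarrow> ratpoly (\<lambda>x. if b then F x else G x)"
  by (cases b) simp_all

lemmas ratpoly_intros = ratpoly_0 ratpoly_1 ratpoly_var ratpoly_add ratpoly_mult ratpoly_uminus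
  ratpoly_diff ratpoly_power ratpoly_sum ratpoly_prod ratpoly_if

lemma ratpoly_eval_mpoly:
  assumes "ratpoly F"
  obtains P where "F = eval_mpoly P"
proof -
  from assms have "\<exists>P. F = eval_mpoly P"
  proof induction
    case (ratpoly_const c)
    have "eval_mpoly (Poly_Mapping.single 0 c) = (\<lambda>_. of_rat c)"
      by (simp add: fun_eq_iff eval_mpoly_single monomial_def)
    then show ?case by metis
  next
    case (ratpoly_var i)
    have "eval_mpoly (Poly_Mapping.single (Poly_Mapping.single i 1) 1) = (\<lambda>x. x i)"
      by (simp add: fun_eq_iff eval_mpoly_single monomial_def)
    then show ?case by metis
  next
    case (ratpoly_add F G)
    then obtain P Q where "F = eval_mpoly P" "G = eval_mpoly Q" by blast
    then show ?case by (intro exI[of _ "P + Q"]) (simp add: fun_eq_iff eval_mpoly_add)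
  next
    case (ratpoly_mult F G)
    then obtain P Q where "F = eval_mpoly P" "G = eval_mpoly Q" by blast
    then show ?case by (intro exI[of _ "P * Q"]) (simp add: fun_eq_iff eval_mpoly_mult)
  qed
  with that show thesis by blast
qed

text \<open>The transfer principle through which genericity enters: a vanishing value at the generic
  point is an identity and holds at specially chosen points too.\<close>

lemma alg_independent_rat_ratpoly_eq_0:
  assumes "alg_independent_rat p" "ratpoly F" "F p = 0"
  shows "F x = 0"
proof -
  obtain P where P: "F = eval_mpoly P" using ratpoly_eval_mpoly[OF assms(2)] .
  with assms have "P = 0" by (simp add: alg_independent_rat_def)
  with P show ?thesis by (simp add: eval_mpoly_def)
qed

lemma ratpoly_det:
  fixes M :: "'c::finite \<Rightarrow> 'c \<Rightarrow> ('i \<Rightarrow> real) \<Rightarrow> real"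
  assumes "\<And>a b. ratpoly (M a b)"
  shows "ratpoly (\<lambda>x. det (\<chi> a b. M a b x))"
proof -
  have "ratpoly (\<lambda>_. of_int n)" for n
    using ratpoly_const[of "of_int n"] by simp
  then show ?thesis
    unfolding det_def vec_lambda_beta
    by (intro ratpoly_sum ratpoly_mult ratpoly_prod assms)
qed

section \<open>Linear systems with polynomial coefficients at a generic point\<close>

lemma det_eq_0_iff_kernel:
  fixes A :: "real^'n^'n"
  shows "det A = 0 \<longleftrightarrow> (\<exists>x. x \<noteq> 0 \<and> A *v x = 0)"
  unfolding det_eq_0_rank matrix_nonfull_linear_equations_eq
  using rank_bound[of A] by linarith

text \<open>The determinant of the Gram matrix detects whether the columns are independent.\<close>

lemma columns_independent_at_generic:
  fixes M :: "'r::finite \<Rightarrow> 'c::finite \<Rightarrow> ('i \<Rightarrow> real) \<Rightarrow> real"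
  assumes p: "alg_independent_rat p" and M: "\<And>r c. ratpoly (M r c)"
    and x: "\<And>z c. (\<And>r. (\<Sum>c\<in>UNIV. M r c x * z c) = 0) \<Longrightarrow> z c = 0"
    and z: "\<And>r. (\<Sum>c\<in>UNIV. M r c p * z c) = 0"
  shows "z c = 0"
proof (rule ccontr)
  assume nz: "z c \<noteq> 0"
  define G where "G y = (\<chi> a b. \<Sum>r\<in>UNIV. M r a y * M r b y)" for y
  have Gv: "(G y *v u) $ a = (\<Sum>r\<in>UNIV. M r a y * (\<Sum>b\<in>UNIV. M r b y * u $ b))" for y u a
    unfolding G_def matrix_vector_mult_def
    by (simp add: sum_distrib_left sum_distrib_right mult.assoc) (rule sum.swap)
  have "G p *v (\<chi> c. z c) = 0"
    by (simp add: vec_eq_iff Gv z)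
  moreover have "(\<chi> c. z c) \<noteq> 0"
    using nz by (auto simp: vec_eq_iff)
  ultimately have "det (G p) = 0"
    using det_eq_0_iff_kernel by blast
  \<comment> \<open>By the transfer principle the Gram determinant then also vanishes at the special
    point \<open>x\<close>.\<close>
  moreover have "ratpoly (\<lambda>x. det (G x))"
    unfolding G_def by (intro ratpoly_det ratpoly_sum ratpoly_mult M)
  ultimately have "det (G x) = 0"
    using alg_independent_rat_ratpoly_eq_0[OF p] by blast
  then obtain u where u: "u \<noteq> 0" "G x *v u = 0"
    using det_eq_0_iff_kernel by blast
  define s where "s r = (\<Sum>b\<in>UNIV. M r b x * u $ b)" for r
  \<comment> \<open>The quadratic form of the Gram matrix at \<open>u\<close> is a sum of squares of
    the row values \<open>s r\<close>; over the reals all of them must vanish.\<close>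
  have "u \<bullet> (G x *v u) = (\<Sum>a\<in>UNIV. \<Sum>r\<in>UNIV. u $ a * (M r a x * s r))"
    by (simp add: inner_vec_def Gv s_def[symmetric] sum_distrib_left)
  also have "\<dots> = (\<Sum>r\<in>UNIV. \<Sum>a\<in>UNIV. u $ a * (M r a x * s r))"
    by (rule sum.swap)
  also have "\<dots> = (\<Sum>r\<in>UNIV. (\<Sum>a\<in>UNIV. M r a x * u $ a) * s r)"
    unfolding sum_distrib_right by (simp add: mult_ac)
  also have "\<dots> = (\<Sum>r\<in>UNIV. (s r)\<^sup>2)"
    by (simp add: s_def[symmetric] power2_eq_square)
  finally have "s r = 0" for r
    using u by (simp add: sum_nonneg_eq_0_iff)
  then have "u $ c = 0" for c
    using x[of "\<lambda>c. u $ c"] by (simp add: s_def)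
  with u show False by (simp add: vec_eq_iff)
qed

section \<open>Extending derivations of the real numbers\<close>

text \<open>A derivation defined on a subring of the reals is encoded by its graph, a subring of the dual
  numbers: the pair \<open>(a, a')\<close> stands for \<open>a + a' \<epsilon>\<close> with \<open>\<epsilon>\<^sup>2 = 0\<close>, and the last
  condition says that the graph is single-valued.\<close>

definition partial_derivation :: "(real \<times> real) set \<Rightarrow> bool" where
  "partial_derivation S \<longleftrightarrow>
     (1, 0) \<in> S \<and>
     (\<forall>a a'. (a, a') \<in> S \<longrightarrow> (- a, - a') \<in> S) \<and>
     (\<forall>a a' b b'. (a, a') \<in> S \<longrightarrow> (b, b') \<in> S \<longrightarrow> (a + b, a' + b') \<in> S) \<and>
     (\<forall>a a' b b'. (a, a') \<in> S \<longrightarrow> (b, b') \<in> S \<longrightarrow> (a * b, a * b' + a' * b) \<in> S) \<and>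
     (\<forall>a'. (0, a') \<in> S \<longrightarrow> a' = 0)"

text \<open>The value which the product rule forces on \<open>poly f t\<close> once \<open>t\<close>
  is given the value \<open>d\<close>; the coefficients of \<open>f'\<close> are the derivatives of
  those of \<open>f\<close>.\<close>

definition adjoin_value :: "real \<Rightarrow> real \<Rightarrow> real poly \<Rightarrow> real poly \<Rightarrow> real" where
  "adjoin_value t d f f' = poly f' t + d * poly (pderiv f) t"

context
  fixes S :: "(real \<times> real) set"
  assumes S: "partial_derivation S"
begin

lemma partial_derivation_1: "(1, 0) \<in> S"
  and partial_derivation_uminus: "(a, a') \<in> S \<Longrightarrow> (- a, - a') \<in> S"
  and partial_derivation_add: "(a, a') \<in> S \<Longrightarrow> (b, b') \<in> S \<Longrightarrow> (a + b, a' + b') \<in> S"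
  and partial_derivation_mult: "(a, a') \<in> S \<Longrightarrow> (b, b') \<in> S \<Longrightarrow> (a * b, a * b' + a' * b) \<in> S"
  and partial_derivation_0D: "(0, a') \<in> S \<Longrightarrow> a' = 0"
  using S unfolding partial_derivation_def by blast+

lemma partial_derivation_0: "(0, 0) \<in> S"
  using partial_derivation_add[OF partial_derivation_1 partial_derivation_uminus[OF partial_derivation_1]]
  by simp

lemma partial_derivation_diff: "(a, a') \<in> S \<Longrightarrow> (b, b') \<in> S \<Longrightarrow> (a - b, a' - b') \<in> S"
  using partial_derivation_add[OF _ partial_derivation_uminus] by fastforce

lemma partial_derivation_unique: "(a, a') \<in> S \<Longrightarrow> (a, b') \<in> S \<Longrightarrow> a' = b'"
  using partial_derivation_diff[of a a' a b'] partial_derivation_0D[of "a' - b'"] by simp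

lemma partial_derivation_sum:
  "(\<And>i. i \<in> A \<Longrightarrow> (f i, f' i) \<in> S) \<Longrightarrow> (\<Sum>i\<in>A. f i, \<Sum>i\<in>A. f' i) \<in> S"
  by (induction A rule: infinite_finite_induct)
    (auto intro: partial_derivation_0 partial_derivation_add)

text \<open>The quotient rule extends the derivation to fractions, so the domain of a maximal
  derivation is a field.\<close>

lemma partial_derivation_fractions:
  "partial_derivation {(b / c, (b' * c - b * c') / c\<^sup>2) | b b' c c'. (b, b') \<in> S \<and> (c, c') \<in> S \<and> c \<noteq> 0}"
    (is "partial_derivation ?T")
proof -
  have T: "(x, x') \<in> ?T"
    if "(b, b') \<in> S" "(c, c') \<in> S" "c \<noteq> 0" "x = b / c" "x' = (b' * c - b * c') / c\<^sup>2" for x x' b b' c c'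
    using that by blast
  show ?thesis
    unfolding partial_derivation_def
  proof (intro conjI allI impI)
    show "(1, 0) \<in> ?T"
      by (rule T[OF partial_derivation_1 partial_derivation_1]) auto
  next
    fix a a' assume "(a, a') \<in> ?T"
    then obtain b b' c c' where *: "(b, b') \<in> S" "(c, c') \<in> S" "c \<noteq> 0" "a = b / c" "a' = (b' * c - b * c') / c\<^sup>2"
      by blast
    show "(- a, - a') \<in> ?T"
      by (rule T[OF partial_derivation_uminus[OF *(1)] *(2,3)]) (use * in \<open>auto simp: field_simps\<close>)
  next
    fix a a' e e' assume "(a, a') \<in> ?T" "(e, e') \<in> ?T"
    then obtain b b' c c' f f' g g'
      where *: "(b, b') \<in> S" "(c, c') \<in> S" "c \<noteq> 0" "a = b / c" "a' = (b' * c - b * c') / c\<^sup>2"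
        and **: "(f, f') \<in> S" "(g, g') \<in> S" "g \<noteq> 0" "e = f / g" "e' = (f' * g - f * g') / g\<^sup>2"
      by blast
    note cg = partial_derivation_mult[OF *(2) **(2)]
    show "(a + e, a' + e') \<in> ?T"
      by (rule T[OF partial_derivation_add[OF partial_derivation_mult[OF *(1) **(2)] partial_derivation_mult[OF **(1) *(2)]] cg])
        (use *(3) **(3) in \<open>simp_all add: *(4,5) **(4,5) field_simps power2_eq_square\<close>)
    show "(a * e, a * e' + a' * e) \<in> ?T"
      by (rule T[OF partial_derivation_mult[OF *(1) **(1)] cg])
        (use *(3) **(3) in \<open>simp_all add: *(4,5) **(4,5) field_simps power2_eq_square\<close>)
  next
    fix a' assume "(0, a') \<in> ?T"
    then show "a' = 0"
      by (auto dest: partial_derivation_0D)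
  qed
qed

text \<open>A relation rather than a map on polynomials, because the derivation is given by its
  graph and may be defined only on some reals.\<close>

definition coeffwise :: "real poly \<Rightarrow> real poly \<Rightarrow> bool" where
  "coeffwise f f' \<longleftrightarrow> (\<forall>n. (coeff f n, coeff f' n) \<in> S)"

lemma coeffwise_uminus: "coeffwise f f' \<Longrightarrow> coeffwise (- f) (- f')"
  by (auto simp: coeffwise_def intro: partial_derivation_uminus)

lemma coeffwise_add: "coeffwise f f' \<Longrightarrow> coeffwise g g' \<Longrightarrow> coeffwise (f + g) (f' + g')"
  by (auto simp: coeffwise_def intro: partial_derivation_add)

lemma coeffwise_diff: "coeffwise f f' \<Longrightarrow> coeffwise g g' \<Longrightarrow> coeffwise (f - g) (f' - g')"
  by (auto simp: coeffwise_def intro: partial_derivation_diff)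

lemma coeffwise_mult: "coeffwise f f' \<Longrightarrow> coeffwise g g' \<Longrightarrow> coeffwise (f * g) (f * g' + f' * g)"
  unfolding coeffwise_def coeff_add coeff_mult sum.distrib[symmetric]
  by (auto intro!: partial_derivation_sum partial_derivation_mult)

lemma coeffwise_monom: "(a, a') \<in> S \<Longrightarrow> coeffwise (monom a n) (monom a' n)"
  by (auto simp: coeffwise_def partial_derivation_0)

text \<open>Natural numbers have derivative 0, so formal differentiation commutes with applying the
  derivation to the coefficients.\<close>

lemma coeffwise_pderiv: "coeffwise f f' \<Longrightarrow> coeffwise (pderiv f) (pderiv f')"
proof -
  assume f: "coeffwise f f'"
  have nat: "(of_nat n, 0) \<in> S" for n
    by (induction n)
      (auto intro: partial_derivation_0 dest: partial_derivation_add[OF partial_derivation_1])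
  show "coeffwise (pderiv f) (pderiv f')"
    unfolding coeffwise_def coeff_pderiv
  proof
    fix n
    have "(coeff f (Suc n), coeff f' (Suc n)) \<in> S"
      using f by (simp add: coeffwise_def)
    from partial_derivation_mult[OF nat[of "Suc n"] this]
    show "(of_nat (Suc n) * coeff f (Suc n), of_nat (Suc n) * coeff f' (Suc n)) \<in> S"
      by simp
  qed
qed

text \<open>The assumption makes the new value independent of the polynomial chosen: two polynomials
  with the same value at \<open>t\<close> differ by one that vanishes there.\<close>

lemma partial_derivation_adjoin:
  assumes "\<And>f f'. coeffwise f f' \<Longrightarrow> poly f t = 0 \<Longrightarrow> adjoin_value t d f f' = 0"
  shows "partial_derivation {(poly f t, adjoin_value t d f f') | f f'. coeffwise f f'}"
    (is "partial_derivation ?T")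
proof -
  have T: "(x, x') \<in> ?T" if "coeffwise f f'" "x = poly f t" "x' = adjoin_value t d f f'" for f f' x x'
    using that by blast
  show ?thesis
    unfolding partial_derivation_def
  proof (intro conjI allI impI)
    show "(1, 0) \<in> ?T"
      by (rule T[OF coeffwise_monom[OF partial_derivation_1, of 0]])
        (auto simp: adjoin_value_def poly_monom pderiv_monom)
  next
    fix a a' assume "(a, a') \<in> ?T"
    then obtain f f' where *: "coeffwise f f'" "a = poly f t" "a' = adjoin_value t d f f'"
      by blast
    show "(- a, - a') \<in> ?T"
      by (rule T[OF coeffwise_uminus[OF *(1)]]) (use * in \<open>auto simp: adjoin_value_def pderiv_minus\<close>)
  next
    fix a a' b b' assume "(a, a') \<in> ?T" "(b, b') \<in> ?T"
    then obtain f f' g g' where *: "coeffwise f f'" "a = poly f t" "a' = adjoin_value t d f f'"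
      and **: "coeffwise g g'" "b = poly g t" "b' = adjoin_value t d g g'"
      by blast
    show "(a + b, a' + b') \<in> ?T"
      by (rule T[OF coeffwise_add[OF *(1) **(1)]])
        (use * ** in \<open>auto simp: adjoin_value_def pderiv_add algebra_simps\<close>)
    show "(a * b, a * b' + a' * b) \<in> ?T"
      by (rule T[OF coeffwise_mult[OF *(1) **(1)]])
        (use * ** in \<open>auto simp: adjoin_value_def pderiv_mult algebra_simps\<close>)
  next
    fix a' assume "(0, a') \<in> ?T"
    then show "a' = 0" using assms by auto
  qed
qed

text \<open>In the algebraic case the value \<open>d\<close> at \<open>t\<close> is forced by differentiating the minimal polynomial
  \<open>g\<close> of \<open>t\<close>, which is separable in characteristic 0.\<close>

lemma adjoin_value_exists:
  assumes inv: "\<And>a a'. (a, a') \<in> S \<Longrightarrow> a \<noteq> 0 \<Longrightarrow> \<exists>b'. (inverse a, b') \<in> S"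
  shows "\<exists>d. \<forall>f f'. coeffwise f f' \<longrightarrow> poly f t = 0 \<longrightarrow> adjoin_value t d f f' = 0"
proof (cases "\<exists>n f f'. coeffwise f f' \<and> f \<noteq> 0 \<and> poly f t = 0 \<and> degree f = n")
  case False
  \<comment> \<open>Here \<open>t\<close> is transcendental over the domain of the derivation, so
    any value may be prescribed; 0 is chosen.\<close>
  have "adjoin_value t 0 f f' = 0" if "coeffwise f f'" "poly f t = 0" for f f'
  proof -
    have "f = 0" using False that by blast
    with that have "f' = 0"
      by (auto simp: coeffwise_def poly_eq_iff dest: partial_derivation_0D)
    with \<open>f = 0\<close> show ?thesis by (simp add: adjoin_value_def)
  qed
  then show ?thesis by blast
next
  case True
  define n where "n = (LEAST n. \<exists>f f'. coeffwise f f' \<and> f \<noteq> 0 \<and> poly f t = 0 \<and> degree f = n)"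
  obtain g g' where g: "coeffwise g g'" "g \<noteq> 0" "poly g t = 0" "degree g = n"
    using LeastI_ex[OF True] unfolding n_def by blast
  have min: "n \<le> degree f" if "coeffwise f f'" "f \<noteq> 0" "poly f t = 0" for f f'
    unfolding n_def by (rule Least_le) (use that in blast)
  have "degree g \<noteq> 0"
  proof
    assume "degree g = 0"
    then obtain a where "g = [:a:]" by (rule degree_eq_zeroE)
    with g(2,3) show False by simp
  qed
  have "poly (pderiv g) t \<noteq> 0"
  proof
    assume "poly (pderiv g) t = 0"
    moreover have "pderiv g \<noteq> 0" "degree (pderiv g) < n"
      using \<open>degree g \<noteq> 0\<close> g(4) by (auto simp: pderiv_eq_0_iff degree_pderiv)
    ultimately show False
      using min[OF coeffwise_pderiv[OF g(1)]] by simp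
  qed
  define d where "d = - poly g' t / poly (pderiv g) t"
  have dg: "adjoin_value t d g g' = 0"
    using \<open>poly (pderiv g) t \<noteq> 0\<close> by (simp add: adjoin_value_def d_def)
  have "adjoin_value t d f f' = 0" if "coeffwise f f'" "poly f t = 0" for f f'
    using that
  proof (induction "degree f" arbitrary: f f' rule: less_induct)
    case less
    show ?case
    proof (cases "f = 0")
      case True
      with less.prems have "f' = 0"
        by (auto simp: coeffwise_def poly_eq_iff dest: partial_derivation_0D)
      with True show ?thesis by (simp add: adjoin_value_def)
    next
      case False
      have le: "n \<le> degree f" by (rule min[OF less.prems(1) False less.prems(2)])
      \<comment> \<open>One step of division by \<open>g\<close>, for which the domain has to be
        closed under inverses: subtracting \<open>h * g\<close> cancels the leading term and leaves
        \<open>r\<close> to the induction.\<close>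
      obtain b' where "(inverse (lead_coeff g), b') \<in> S"
        using g inv unfolding coeffwise_def by (metis leading_coeff_0_iff)
      moreover have "(lead_coeff f, coeff f' (degree f)) \<in> S"
        using less.prems by (simp add: coeffwise_def)
      ultimately obtain c' where c: "(lead_coeff f * inverse (lead_coeff g), c') \<in> S"
        using partial_derivation_mult by blast
      define h where "h = monom (lead_coeff f * inverse (lead_coeff g)) (degree f - n)"
      define h' where "h' = monom c' (degree f - n)"
      have h: "coeffwise h h'"
        unfolding h_def h'_def by (rule coeffwise_monom[OF c])
      define r where "r = f - h * g"
      define r' where "r' = f' - (h * g' + h' * g)"
      have r: "coeffwise r r'" "poly r t = 0"
        unfolding r_def r'_def
        using coeffwise_diff[OF less.prems(1) coeffwise_mult[OF h g(1)]] less.prems g by auto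
      have "adjoin_value t d r r' = 0"
      proof (cases "r = 0")
        case True
        with r have "r' = 0"
          by (auto simp: coeffwise_def poly_eq_iff dest: partial_derivation_0D)
        with True show ?thesis by (simp add: adjoin_value_def)
      next
        case False
        have nz: "lead_coeff f * inverse (lead_coeff g) \<noteq> 0"
          using \<open>f \<noteq> 0\<close> g(2) by simp
        then have "h \<noteq> 0" by (simp add: h_def)
        have deg: "degree (h * g) = degree f"
          using le g nz \<open>h \<noteq> 0\<close> by (simp add: degree_mult_eq h_def degree_monom_eq)
        moreover have "lead_coeff (h * g) = lead_coeff f"
          using g nz by (simp add: lead_coeff_mult h_def degree_monom_eq)
        ultimately have "coeff r (degree f) = 0"
          by (simp add: r_def)
        moreover have "degree r \<le> degree f"
          unfolding r_def using deg by (metis degree_diff_le order_refl)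
        ultimately have "degree r < degree f"
          using False by (metis leading_coeff_0_iff le_neq_implies_less)
        from less.hyps[OF this r] show ?thesis .
      qed
      \<comment> \<open>The two extra terms come from the product rule for \<open>h * g\<close> and
        vanish, since both \<open>poly g t\<close> and \<open>adjoin_value t d g g'\<close> are
        0.\<close>
      moreover have "adjoin_value t d f f' =
          adjoin_value t d r r' + poly h t * adjoin_value t d g g' + poly g t * adjoin_value t d h h'"
        by (simp add: adjoin_value_def r_def r'_def pderiv_diff pderiv_mult algebra_simps)
      ultimately show ?thesis using dg g by simp
    qed
  qed
  then show ?thesis by blast
qed

end

text \<open>Zorn's lemma gives a maximal extension. Maximality against fractions makes its domain a
  field, and maximality against adjoining one number makes the domain all of the reals.\<close>

lemma partial_derivation_extends:
  assumes S: "partial_derivation S"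
  obtains D :: "real \<Rightarrow> real" where "\<And>a b. D (a + b) = D a + D b"
    "\<And>a b. D (a * b) = a * D b + D a * b" "\<And>a a'. (a, a') \<in> S \<Longrightarrow> D a = a'"
proof -
  let ?A = "{T. S \<subseteq> T \<and> partial_derivation T}"
  have "\<exists>M\<in>?A. \<forall>T\<in>?A. M \<subseteq> T \<longrightarrow> T = M"
  proof (rule subset_Zorn_nonempty)
    show "?A \<noteq> {}" using S by blast
  next
    fix C assume C: "C \<noteq> {}" "subset.chain ?A C"
    then have der: "partial_derivation T" "S \<subseteq> T" if "T \<in> C" for T
      using that by (auto simp: subset_chain_def)
    have two: "\<exists>T\<in>C. x \<in> T \<and> y \<in> T" if xy: "x \<in> \<Union>C" "y \<in> \<Union>C" for x y
    proof -
      obtain X Y where "X \<in> C" "x \<in> X" "Y \<in> C" "y \<in> Y" using xy by blast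
      moreover from this have "X \<subseteq> Y \<or> Y \<subseteq> X"
        using C(2) by (auto simp: subset_chain_def)
      ultimately show ?thesis by blast
    qed
    obtain T0 where "T0 \<in> C" using C by blast
    have "partial_derivation (\<Union>C)"
      unfolding partial_derivation_def
    proof (intro conjI allI impI)
      show "(1, 0) \<in> \<Union>C"
        using der(1)[OF \<open>T0 \<in> C\<close>] \<open>T0 \<in> C\<close> partial_derivation_1 by blast
      show "(- a, - a') \<in> \<Union>C" if "(a, a') \<in> \<Union>C" for a a'
        using that der(1) partial_derivation_uminus by blast
      show "(a + b, a' + b') \<in> \<Union>C" if "(a, a') \<in> \<Union>C" "(b, b') \<in> \<Union>C" for a a' b b'
        using two[OF that] der(1) partial_derivation_add by blast
      show "(a * b, a * b' + a' * b) \<in> \<Union>C" if "(a, a') \<in> \<Union>C" "(b, b') \<in> \<Union>C" for a a' b b'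
        using two[OF that] der(1) partial_derivation_mult by blast
      show "a' = 0" if "(0, a') \<in> \<Union>C" for a'
        using that der(1) partial_derivation_0D by blast
    qed
    then show "\<Union>C \<in> ?A" using der(2) \<open>T0 \<in> C\<close> by blast
  qed
  then obtain M where M: "S \<subseteq> M" "partial_derivation M"
    and max: "\<And>T. partial_derivation T \<Longrightarrow> M \<subseteq> T \<Longrightarrow> T = M"
    by (smt (verit) mem_Collect_eq order_trans)
  note pd = partial_derivation_1[OF M(2)] partial_derivation_0[OF M(2)]
  have inv: "\<exists>b'. (inverse a, b') \<in> M" if "(a, a') \<in> M" "a \<noteq> 0" for a a'
  proof -
    let ?T = "{(b / c, (b' * c - b * c') / c\<^sup>2) | b b' c c'. (b, b') \<in> M \<and> (c, c') \<in> M \<and> c \<noteq> 0}"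
    have T: "(x, x') \<in> ?T"
      if "(b, b') \<in> M" "(c, c') \<in> M" "c \<noteq> 0" "x = b / c" "x' = (b' * c - b * c') / c\<^sup>2" for x x' b b' c c'
      using that by blast
    have "M \<subseteq> ?T"
    proof (rule subrelI)
      fix a a' assume "(a, a') \<in> M"
      then show "(a, a') \<in> ?T"
        by (rule T[OF _ pd(1)]) auto
    qed
    from max[OF partial_derivation_fractions[OF M(2)] this] have "?T = M" .
    moreover have "(1 / a, (0 * a - 1 * a') / a\<^sup>2) \<in> ?T"
      by (rule T[OF pd(1) that]) auto
    ultimately show ?thesis by (metis inverse_eq_divide)
  qed
  have total: "\<exists>d. (t, d) \<in> M" for t
  proof -
    have "\<exists>d. \<forall>f f'. coeffwise M f f' \<longrightarrow> poly f t = 0 \<longrightarrow> adjoin_value t d f f' = 0"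
      by (rule adjoin_value_exists[OF M(2)]) (rule inv)
    then obtain d where
      d: "\<And>f f'. coeffwise M f f' \<Longrightarrow> poly f t = 0 \<Longrightarrow> adjoin_value t d f f' = 0"
      by blast
    let ?T = "{(poly f t, adjoin_value t d f f') | f f'. coeffwise M f f'}"
    have T: "(x, x') \<in> ?T" if "coeffwise M f f'" "x = poly f t" "x' = adjoin_value t d f f'" for f f' x x'
      using that by blast
    have "M \<subseteq> ?T"
    proof (rule subrelI)
      fix a a' assume "(a, a') \<in> M"
      show "(a, a') \<in> ?T"
        by (rule T[OF coeffwise_monom[OF M(2) \<open>(a, a') \<in> M\<close>, of 0]])
          (auto simp: adjoin_value_def poly_monom pderiv_monom)
    qed
    from max[OF partial_derivation_adjoin[OF M(2) d] this] have "?T = M" by simp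
    moreover have "(t, d) \<in> ?T"
      by (rule T[OF coeffwise_monom[OF M(2) pd(1), of 1]])
        (auto simp: adjoin_value_def poly_monom pderiv_monom)
    ultimately show ?thesis by blast
  qed
  then obtain D where D: "\<And>a. (a, D a) \<in> M" by metis
  show thesis
  proof
    show "D (a + b) = D a + D b" for a b
      using partial_derivation_unique[OF M(2) D partial_derivation_add[OF M(2) D D]] .
    show "D (a * b) = a * D b + D a * b" for a b
      using partial_derivation_unique[OF M(2) D partial_derivation_mult[OF M(2) D D]] .
    show "D a = a'" if "(a, a') \<in> S" for a a'
      using partial_derivation_unique[OF M(2) D] that M(1) by blast
  qed
qed

section \<open>Generic configurations\<close>

text \<open>The equations are a linear system for the coefficients. Its columns are independent when
  the points contain the vertices of a standard simplex, hence also at the generic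
  configuration.\<close>

lemma generic_affine_functions_independent:
  fixes x :: "'v::finite \<times> 'c::finite \<Rightarrow> real"
  assumes x: "alg_independent_rat x" and card: "card C < card S"
    and eq: "\<And>v. v \<in> S \<Longrightarrow> a + (\<Sum>i\<in>C. b i * x (v, i)) = 0"
  shows "a = 0" and "i \<in> C \<Longrightarrow> b i = 0"
proof -
  \<comment> \<open>Rows \<open>Inl v\<close> with \<open>v\<close> in \<open>S\<close> are the
    equations. Since the columns range over a whole type, the rows \<open>Inr j\<close> force the
    coefficients outside \<open>C\<close> to be 0.\<close>
  define M :: "'v + 'c \<Rightarrow> 'c option \<Rightarrow> ('v \<times> 'c \<Rightarrow> real) \<Rightarrow> real" where
    "M r k y = (case r of
        Inl v \<Rightarrow> (case k of None \<Rightarrow> if v \<in> S then 1 else 0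
                          | Some i \<Rightarrow> if v \<in> S \<and> i \<in> C then y (v, i) else 0)
      | Inr j \<Rightarrow> if j \<notin> C \<and> k = Some j then 1 else 0)" for r k y
  have sum_option: "(\<Sum>k\<in>UNIV. f k) = f None + (\<Sum>i\<in>UNIV. f (Some i))"
    for f :: "'c option \<Rightarrow> real"
    by (simp add: UNIV_option_conv sum.reindex)
  have rowS: "(\<Sum>k\<in>UNIV. M (Inl v) k y * z k) = z None + (\<Sum>i\<in>C. z (Some i) * y (v, i))"
    if "v \<in> S" for v y z
  proof -
    have "(\<Sum>i\<in>UNIV. M (Inl v) (Some i) y * z (Some i)) = (\<Sum>i\<in>C. z (Some i) * y (v, i))"
      by (rule sum.mono_neutral_cong_right) (auto simp: M_def that)
    then show ?thesis by (simp add: sum_option M_def that)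
  qed
  have rowC: "(\<Sum>k\<in>UNIV. M (Inr j) k y * z k) = z (Some j)" if "j \<notin> C" for j y z
    by (simp add: sum_option M_def that if_distrib[of "\<lambda>u. u * _"] cong: if_cong)
  have "S \<noteq> {}" using card by auto
  then obtain v0 where "v0 \<in> S" by blast
  then have "card C \<le> card (S - {v0})" using card by simp
  then obtain \<phi> where \<phi>: "\<phi> ` C \<subseteq> S - {v0}" "inj_on \<phi> C"
    using card_le_inj[of C "S - {v0}"] by auto
  \<comment> \<open>In the coordinates in \<open>C\<close>, \<open>v0\<close> is the origin and
    \<open>\<phi> i\<close> is the unit vector of \<open>i\<close>.\<close>
  define y :: "'v \<times> 'c \<Rightarrow> real" where "y = (\<lambda>(v, i). if v = \<phi> i then 1 else 0)"
  define z where "z k = (case k of None \<Rightarrow> a | Some i \<Rightarrow> if i \<in> C then b i else 0)" for k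
  have z0: "z k = 0" for k
  proof (rule columns_independent_at_generic[OF x, where M = M and x = y and z = z])
    show "ratpoly (M r k)" for r k
      unfolding M_def by (cases r; cases k) (auto intro!: ratpoly_intros)
  next
    fix z k assume z: "\<And>r. (\<Sum>k\<in>UNIV. M r k y * z k) = 0"
    have "(\<Sum>i\<in>C. z (Some i) * y (v0, i)) = 0"
      using \<phi>(1) by (intro sum.neutral) (auto simp: y_def)
    then have None: "z None = 0"
      using z[of "Inl v0"] rowS[OF \<open>v0 \<in> S\<close>] by simp
    have "z (Some j) = 0" for j
    proof (cases "j \<in> C")
      case True
      have "(\<Sum>i\<in>C. z (Some i) * y (\<phi> j, i)) = (\<Sum>i\<in>C. if i = j then z (Some i) else 0)"
        using \<phi>(2) True by (intro sum.cong) (auto simp: y_def inj_on_def)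
      also have "\<dots> = z (Some j)" using True by simp
      finally show ?thesis
        using z[of "Inl (\<phi> j)"] rowS[of "\<phi> j" y z] \<phi>(1) True None by auto
    next
      case False
      then show ?thesis using z[of "Inr j"] rowC by simp
    qed
    with None show "z k = 0" by (cases k) auto
  next
    fix r
    show "(\<Sum>k\<in>UNIV. M r k x * z k) = 0"
    proof (cases r)
      case (Inl v)
      show ?thesis
      proof (cases "v \<in> S")
        case True
        then show ?thesis using eq[OF True] by (simp add: Inl rowS z_def)
      qed (simp add: Inl M_def sum_option)
    next
      case (Inr j)
      show ?thesis
      proof (cases "j \<in> C")
        case False
        then show ?thesis using rowC[OF False, of x z] by (simp add: Inr z_def)
      qed (simp add: Inr M_def)
    qed
  qed
  show "a = 0" using z0[of None] by (simp add: z_def)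
  show "b i = 0" if "i \<in> C" using z0[of "Some i"] that by (simp add: z_def)
qed

text \<open>Dual to the previous lemma: the unknowns are now the coefficients of an affine
  dependency, and the same standard simplex serves as test configuration.\<close>

lemma generic_points_affinely_independent:
  fixes x :: "'v::finite \<times> 'c::finite \<Rightarrow> real"
  assumes x: "alg_independent_rat x" and card: "card T \<le> card C + 1"
    and sum0: "(\<Sum>u\<in>T. c u) = 0" and sumx: "\<And>i. i \<in> C \<Longrightarrow> (\<Sum>u\<in>T. c u * x (u, i)) = 0"
    and "u \<in> T"
  shows "c u = 0"
proof -
  define M :: "'v + 'c option \<Rightarrow> 'v \<Rightarrow> ('v \<times> 'c \<Rightarrow> real) \<Rightarrow> real" where
    "M r u y = (case r of
        Inl w \<Rightarrow> if w \<notin> T \<and> u = w then 1 else 0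
      | Inr k \<Rightarrow> (case k of None \<Rightarrow> if u \<in> T then 1 else 0
                          | Some i \<Rightarrow> if i \<in> C \<and> u \<in> T then y (u, i) else 0))" for r u y
  have row1: "(\<Sum>u\<in>UNIV. M (Inl w) u y * z u) = (if w \<in> T then 0 else z w)" for w y z
    by (simp add: M_def if_distrib[of "\<lambda>u. u * _"] cong: if_cong)
  have row2: "(\<Sum>u\<in>UNIV. M (Inr None) u y * z u) = (\<Sum>u\<in>T. z u)" for y z
    by (rule sum.mono_neutral_cong_right) (auto simp: M_def)
  have row3: "(\<Sum>u\<in>UNIV. M (Inr (Some i)) u y * z u) = (\<Sum>u\<in>T. z u * y (u, i))" if "i \<in> C" for y z i
    by (rule sum.mono_neutral_cong_right) (auto simp: M_def that)
  have "card (T - {u}) \<le> card C" using card \<open>u \<in> T\<close> by simp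
  then obtain \<psi> where \<psi>: "\<psi> ` (T - {u}) \<subseteq> C" "inj_on \<psi> (T - {u})"
    using card_le_inj[of "T - {u}" C] by auto
  \<comment> \<open>The point \<open>u\<close> sits at the origin, the other points of
    \<open>T\<close> at distinct unit vectors.\<close>
  define y :: "'v \<times> 'c \<Rightarrow> real" where "y = (\<lambda>(v, i). if v \<noteq> u \<and> \<psi> v = i then 1 else 0)"
  define z where "z w = (if w \<in> T then c w else 0)" for w
  have "z u = 0"
  proof (rule columns_independent_at_generic[OF x, where M = M and x = y and z = z])
    show "ratpoly (M r k)" for r k
      unfolding M_def
      by (cases r; cases "projr r") (auto intro!: ratpoly_intros)
  next
    fix z w assume z: "\<And>r. (\<Sum>k\<in>UNIV. M r k y * z k) = 0"
    have *: "z w = 0" if "w \<noteq> u" for w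
    proof (cases "w \<in> T")
      case True
      with that \<psi>(1) have "\<psi> w \<in> C" by auto
      have "(\<Sum>v\<in>T. z v * y (v, \<psi> w)) = (\<Sum>v\<in>T. if v = w then z v else 0)"
        using \<psi>(2) True that by (intro sum.cong) (auto simp: y_def inj_on_def)
      also have "\<dots> = z w" using True by simp
      finally show ?thesis
        using z[of "Inr (Some (\<psi> w))"] row3[OF \<open>\<psi> w \<in> C\<close>] by simp
    next
      case False
      then show ?thesis using z[of "Inl w"] row1 by simp
    qed
    moreover have "(\<Sum>v\<in>T. z v) = z u"
      using \<open>u \<in> T\<close> * by (subst sum.remove[of _ u]) auto
    then have "z u = 0" using z[of "Inr None"] row2 by simp
    ultimately show "z w = 0" by metis
  next
    fix r
    show "(\<Sum>k\<in>UNIV. M r k x * z k) = 0"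
    proof (cases r)
      case (Inl w)
      then show ?thesis by (simp add: row1 z_def)
    next
      case (Inr k)
      show ?thesis
      proof (cases k)
        case None
        then show ?thesis using sum0 by (simp add: Inr row2 z_def)
      next
        case (Some i)
        show ?thesis
        proof (cases "i \<in> C")
          case True
          then show ?thesis using sumx[OF True] by (simp add: Inr Some row3 z_def)
        qed (simp add: Inr Some M_def)
      qed
    qed
  qed
  with \<open>u \<in> T\<close> show ?thesis by (simp add: z_def)
qed

text \<open>Induction on the dimension: the coefficients of a form with the required property are
  determined by linear equations that are polynomial in the configuration, so it suffices to treat one
  special configuration. Put one vertex at the apex \<open>e\<^sub>c\<close> of a cone over a generic configuration of the
  other vertices in the hyperplane where the coordinate \<open>c\<close> is zero. The edges of the base force the form
  to vanish on the hyperplane, after which the conditions at the apex become affine.\<close>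

lemma generic_edge_directions_on_no_quadric:
  fixes x :: "'v::finite \<times> 'c::finite \<Rightarrow> real"
  assumes x: "alg_independent_rat x" and irrefl: "\<And>v. \<not> adj v v"
    and W: "W \<noteq> {}" and deg: "\<And>v. v \<in> W \<Longrightarrow> card C \<le> card {u \<in> W. adj v u}"
    and sym: "\<And>i j. i \<in> C \<Longrightarrow> j \<in> C \<Longrightarrow> Q i j = Q j i"
    and zero: "\<And>v u. v \<in> W \<Longrightarrow> u \<in> W \<Longrightarrow> adj v u \<Longrightarrow>
        (\<Sum>i\<in>C. \<Sum>j\<in>C. Q i j * ((x (v, i) - x (u, i)) * (x (v, j) - x (u, j)))) = 0"
    and "i \<in> C" "j \<in> C"
  shows "Q i j = 0"
  using finite[of C] W deg sym zero \<open>i \<in> C\<close> \<open>j \<in> C\<close>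
proof (induction C arbitrary: W Q i j rule: finite_induct)
  case empty
  then show ?case by simp
next
  case (insert c C)
  let ?C = "insert c C"
  \<comment> \<open>The unknowns are the entries of the form. Rows \<open>Inl\<close> are the edge
    conditions; rows \<open>Inr\<close> impose symmetry on \<open>?C\<close> and zeros
    elsewhere.\<close>
  define M :: "('v \<times> 'v) + ('c \<times> 'c) \<Rightarrow> 'c \<times> 'c \<Rightarrow> ('v \<times> 'c \<Rightarrow> real) \<Rightarrow> real" where
    "M r k y = (case r of
        Inl (v, u) \<Rightarrow> if v \<in> W \<and> u \<in> W \<and> adj v u \<and> fst k \<in> ?C \<and> snd k \<in> ?C
          then (y (v, fst k) - y (u, fst k)) * (y (v, snd k) - y (u, snd k)) else 0
      | Inr (a, b) \<Rightarrow> if a \<in> ?C \<and> b \<in> ?C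
          then (if k = (a, b) then 1 else 0) - (if k = (b, a) then 1 else 0)
          else (if k = (a, b) then 1 else 0))" for r k y
  have row1: "(\<Sum>k\<in>UNIV. M (Inl (v, u)) k y * z k) =
      (\<Sum>i\<in>?C. \<Sum>j\<in>?C. z (i, j) * ((y (v, i) - y (u, i)) * (y (v, j) - y (u, j))))"
    if "v \<in> W" "u \<in> W" "adj v u" for v u y z
    unfolding sum.cartesian_product
    by (rule sum.mono_neutral_cong_right) (auto simp: M_def that)
  have row2: "(\<Sum>k\<in>UNIV. M (Inr (a, b)) k y * z k) =
      (if a \<in> ?C \<and> b \<in> ?C then z (a, b) - z (b, a) else z (a, b))" for a b y z
    by (simp add: M_def left_diff_distrib sum_subtractf if_distrib[of "\<lambda>u. u * _"] cong: if_cong)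
  obtain v1 where v1: "v1 \<in> W" using insert.prems by blast
  define N where "N = {u \<in> W. adj v1 u}"
  \<comment> \<open>The degree bound for \<open>insert c C\<close> leaves one neighbour more than
    \<open>card C\<close>, enough to kill an affine function in the coordinates of
    \<open>C\<close>.\<close>
  have N: "card C < card N" "v1 \<notin> N" "N \<subseteq> W"
    using insert.prems(2)[OF v1] insert.hyps irrefl by (auto simp: N_def)
  define y :: "'v \<times> 'c \<Rightarrow> real" where
    "y = (\<lambda>(v, i). if v = v1 then (if i = c then 1 else 0) else if i = c then 0 else x (v, i))"
  define q where "q = (\<lambda>(i, j). if i \<in> ?C \<and> j \<in> ?C then Q i j else 0)"
  have "q (i, j) = 0"
  proof (rule columns_independent_at_generic[OF x, where M = M and x = y and z = q])
    show "ratpoly (M r k)" for r k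
    proof (cases r)
      case (Inl e)
      show ?thesis
        unfolding M_def Inl
        by (cases e) (simp only: sum.case prod.case, intro ratpoly_if ratpoly_mult ratpoly_diff ratpoly_var ratpoly_0)
    next
      case (Inr e)
      show ?thesis
        unfolding M_def Inr
        by (cases e) (simp only: sum.case prod.case, intro ratpoly_if ratpoly_diff ratpoly_1 ratpoly_0)
    qed
  next
    fix z :: "'c \<times> 'c \<Rightarrow> real" and k :: "'c \<times> 'c" assume z: "\<And>r. (\<Sum>k\<in>UNIV. M r k y * z k) = 0"
    have out: "z (a, b) = 0" if "\<not> (a \<in> ?C \<and> b \<in> ?C)" for a b
      using z[of "Inr (a, b)"] row2[of a b y z] that by (auto split: if_splits)
    have zsym: "z (a, b) = z (b, a)" for a b
      using z[of "Inr (a, b)"] row2[of a b y z] out[of a b] out[of b a] by (auto split: if_splits)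
    have zadj: "(\<Sum>i\<in>?C. \<Sum>j\<in>?C. z (i, j) * ((y (v, i) - y (u, i)) * (y (v, j) - y (u, j)))) = 0"
      if "v \<in> W" "u \<in> W" "adj v u" for v u
      using z[of "Inl (v, u)"] row1[OF that] by simp
    have base: "z (i, j) = 0" if ij: "i \<in> C" "j \<in> C" for i j
    proof (rule insert.IH[of "W - {v1}" "\<lambda>i j. z (i, j)"])
      have "N \<noteq> {}" using N(1) by auto
      then show "W - {v1} \<noteq> {}" using N by blast
    next
      fix v assume v: "v \<in> W - {v1}"
      \<comment> \<open>Deleting the apex costs each vertex at most one neighbour, which matches the
        drop in dimension.\<close>
      have "card {u \<in> W. adj v u} \<le> card (insert v1 {u \<in> W - {v1}. adj v u})"
        by (intro card_mono) auto
      also have "\<dots> \<le> Suc (card {u \<in> W - {v1}. adj v u})"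
        by (rule card_insert_le_m1) auto
      finally show "card C \<le> card {u \<in> W - {v1}. adj v u}"
        using insert.prems(2)[of v] v insert.hyps by simp
    next
      fix v u assume vu: "v \<in> W - {v1}" "u \<in> W - {v1}" "adj v u"
      have "(\<Sum>i\<in>?C. \<Sum>j\<in>?C. z (i, j) * ((y (v, i) - y (u, i)) * (y (v, j) - y (u, j)))) =
          (\<Sum>i\<in>C. \<Sum>j\<in>C. z (i, j) * ((y (v, i) - y (u, i)) * (y (v, j) - y (u, j))))"
        using insert.hyps vu by (simp add: y_def)
      also have "\<dots> = (\<Sum>i\<in>C. \<Sum>j\<in>C. z (i, j) * ((x (v, i) - x (u, i)) * (x (v, j) - x (u, j))))"
        using insert.hyps vu by (intro sum.cong) (auto simp: y_def)
      finally show "\<dots> = 0"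
        using zadj[of v u] vu by simp
    qed (use zsym ij in auto)
    \<comment> \<open>An edge at the apex has \<open>c\<close>-coordinate 1, and by
      \<open>base\<close> the terms of degree two in the remaining coordinates are gone, so the
      condition is affine in \<open>u\<close>.\<close>
    have apex: "z (c, c) + (\<Sum>i\<in>C. (- 2 * z (c, i)) * x (u, i)) = 0" if "u \<in> N" for u
    proof -
      have u: "u \<in> W" "adj v1 u" "u \<noteq> v1" using that N by (auto simp: N_def)
      have "(\<Sum>i\<in>?C. \<Sum>j\<in>?C. z (i, j) * ((y (v1, i) - y (u, i)) * (y (v1, j) - y (u, j)))) =
          z (c, c) + (\<Sum>j\<in>C. z (c, j) * (y (v1, j) - y (u, j)))
            + (\<Sum>i\<in>C. z (i, c) * (y (v1, i) - y (u, i)))"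
        using insert.hyps u base by (simp add: y_def sum.distrib)
      also have "\<dots> = z (c, c) + (\<Sum>i\<in>C. 2 * z (c, i) * (y (v1, i) - y (u, i)))"
      proof -
        have "(\<Sum>i\<in>C. z (i, c) * (y (v1, i) - y (u, i))) = (\<Sum>i\<in>C. z (c, i) * (y (v1, i) - y (u, i)))"
          by (intro sum.cong refl) (simp only: zsym[where b = c])
        then show ?thesis by (simp add: mult.assoc sum_distrib_left[symmetric])
      qed
      also have "(\<Sum>i\<in>C. 2 * z (c, i) * (y (v1, i) - y (u, i))) = (\<Sum>i\<in>C. (- 2 * z (c, i)) * x (u, i))"
      proof (intro sum.cong refl)
        fix i assume "i \<in> C"
        then have "y (v1, i) - y (u, i) = - x (u, i)"
          using insert.hyps u by (auto simp: y_def)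
        then show "2 * z (c, i) * (y (v1, i) - y (u, i)) = (- 2 * z (c, i)) * x (u, i)"
          by simp
      qed
      finally show ?thesis using zadj[OF v1 u(1,2)] by simp
    qed
    have ci: "z (c, i) = 0" if "i \<in> C" for i
      using generic_affine_functions_independent(2)[OF x N(1) apex that] by simp
    have cc: "z (c, c) = 0"
      by (rule generic_affine_functions_independent(1)[OF x N(1) apex])
    obtain a b where "k = (a, b)" by (cases k)
    then show "z k = 0"
      using out base ci cc zsym by (metis insert_iff)
  next
    fix r
    show "(\<Sum>k\<in>UNIV. M r k x * q k) = 0"
    proof (cases r)
      case (Inl e)
      obtain v u where e: "e = (v, u)" by (cases e)
      show ?thesis
      proof (cases "v \<in> W \<and> u \<in> W \<and> adj v u")
        case True
        then show ?thesis
          using insert.prems(4)[of v u] unfolding Inl e by (subst row1) (auto simp: q_def)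
      qed (auto simp: Inl e M_def intro!: sum.neutral)
    next
      case (Inr e)
      obtain a b where e: "e = (a, b)" by (cases e)
      show ?thesis
        using insert.prems(3)[of a b] unfolding Inr e row2 by (auto simp: q_def)
    qed
  qed
  with insert.prems show ?case by (simp add: q_def)
qed

section \<open>Derivations at a generic point\<close>

text \<open>A derivation in the purely algebraic sense; a nonzero one is discontinuous.\<close>

locale real_derivation =
  fixes D :: "real \<Rightarrow> real"
  assumes add: "D (a + b) = D a + D b" and mult: "D (a * b) = a * D b + D a * b"
begin

lemma zero: "D 0 = 0"
  using add[of 0 0] by simp

lemma diff: "D (a - b) = D a - D b"
  using add[of "a - b" b] by simp

lemma sum: "D (\<Sum>a\<in>A. f a) = (\<Sum>a\<in>A. D (f a))"
  by (induction A rule: infinite_finite_induct) (auto simp: zero add)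

lemma square: "D (a\<^sup>2) = 2 * (a * D a)"
  by (simp add: power2_eq_square mult)

end

text \<open>The pairs of a value \<open>F x\<close> and a directional derivative of \<open>F\<close>
  at \<open>q\<close> are closed under the ring operations. They form a single-valued graph because
  \<open>F x = 0\<close> makes \<open>F\<close> zero everywhere, and then its derivative is
  0.\<close>

lemma generic_derivation:
  assumes x: "alg_independent_rat x"
  obtains D where "real_derivation D"
    "\<And>F d. ratpoly F \<Longrightarrow> F q = F x \<Longrightarrow>
       ((\<lambda>t. F (\<lambda>i. q i + t * w i)) has_real_derivative d) (at 0) \<Longrightarrow> D (F x) = d"
proof -
  define S where "S = {(a, d). \<exists>F. ratpoly F \<and> F x = a \<and> F q = a \<and>
      ((\<lambda>t. F (\<lambda>i. q i + t * w i)) has_real_derivative d) (at 0)}"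
  have S: "(a, d) \<in> S" if "ratpoly F" "F x = a" "F q = a"
    "((\<lambda>t. F (\<lambda>i. q i + t * w i)) has_real_derivative d) (at 0)" for a d F
    unfolding S_def using that by blast
  have "partial_derivation S"
    unfolding partial_derivation_def
  proof (intro conjI allI impI)
    show "(1, 0) \<in> S"
      by (rule S[OF ratpoly_1]) auto
  next
    fix a d assume "(a, d) \<in> S"
    then obtain F where F: "ratpoly F" "F x = a" "F q = a"
      "((\<lambda>t. F (\<lambda>i. q i + t * w i)) has_real_derivative d) (at 0)" by (auto simp: S_def)
    show "(- a, - d) \<in> S"
      by (rule S[OF ratpoly_uminus[OF F(1)]]) (use F in \<open>auto intro: DERIV_minus\<close>)
  next
    fix a d b e assume "(a, d) \<in> S" "(b, e) \<in> S"
    then obtain F G where F: "ratpoly F" "F x = a" "F q = a"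
      "((\<lambda>t. F (\<lambda>i. q i + t * w i)) has_real_derivative d) (at 0)"
      and G: "ratpoly G" "G x = b" "G q = b"
      "((\<lambda>t. G (\<lambda>i. q i + t * w i)) has_real_derivative e) (at 0)"
      by (auto simp: S_def)
    show "(a + b, d + e) \<in> S"
      by (rule S[OF ratpoly_add[OF F(1) G(1)]]) (use F G in \<open>auto intro: DERIV_add\<close>)
    show "(a * b, a * e + d * b) \<in> S"
    proof (rule S[OF ratpoly_mult[OF F(1) G(1)]])
      have "((\<lambda>t. F (\<lambda>i. q i + t * w i) * G (\<lambda>i. q i + t * w i)) has_real_derivative
          d * G (\<lambda>i. q i + 0 * w i) + e * F (\<lambda>i. q i + 0 * w i)) (at 0)"
        by (rule DERIV_mult[OF F(4) G(4)])
      then show "((\<lambda>t. F (\<lambda>i. q i + t * w i) * G (\<lambda>i. q i + t * w i)) has_real_derivative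
          a * e + d * b) (at 0)"
        using F G by (simp add: algebra_simps)
    qed (use F G in auto)
  next
    fix d assume "(0, d) \<in> S"
    then obtain F where F: "ratpoly F" "F x = 0"
      "((\<lambda>t. F (\<lambda>i. q i + t * w i)) has_real_derivative d) (at 0)" by (auto simp: S_def)
    have "F y = 0" for y
      using alg_independent_rat_ratpoly_eq_0[of x F y] x F by simp
    with F(3) have "((\<lambda>_. 0) has_real_derivative d) (at 0)" by simp
    from DERIV_unique[OF this DERIV_const] show "d = 0" .
  qed
  then obtain D where D: "\<And>a b. D (a + b) = D a + D b" "\<And>a b. D (a * b) = a * D b + D a * b"
    "\<And>a d. (a, d) \<in> S \<Longrightarrow> D a = d"
    using partial_derivation_extends by blast
  show thesis
  proof
    show "real_derivation D" by unfold_locales (rule D)+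
    show "D (F x) = d" if "ratpoly F" "F q = F x"
      "((\<lambda>t. F (\<lambda>i. q i + t * w i)) has_real_derivative d) (at 0)" for F d
      by (rule D(3)) (rule S[OF that(1) refl that(2,3)])
  qed
qed

text \<open>A representation with the smallest number of terms is one with independent coefficients.\<close>

lemma decomposition_over_subring:
  fixes s :: "'e::finite \<Rightarrow> real" and A :: "real set"
  assumes A: "0 \<in> A" "1 \<in> A" "\<forall>a\<in>A. \<forall>b\<in>A. a - b \<in> A" "\<forall>a\<in>A. \<forall>b\<in>A. a * b \<in> A"
  shows "\<exists>(I :: 'e set) b \<tau>. (\<forall>e. s e = (\<Sum>l\<in>I. b l * \<tau> l e)) \<and> (\<forall>l e. \<tau> l e \<in> A) \<and>
    (\<forall>l e. s e = 0 \<longrightarrow> \<tau> l e = 0) \<and>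
    (\<forall>a. (\<forall>l. a l \<in> A) \<longrightarrow> (\<Sum>l\<in>I. b l * a l) = 0 \<longrightarrow> (\<forall>l\<in>I. a l = 0))"
proof -
  define rep where "rep I b \<tau> \<longleftrightarrow> (\<forall>e. s e = (\<Sum>l\<in>I. b l * \<tau> l e)) \<and> (\<forall>l e. \<tau> l e \<in> A)
    \<and> (\<forall>l e. s e = 0 \<longrightarrow> \<tau> l e = 0)" for I :: "'e set" and b \<tau>
  \<comment> \<open>Some representation exists: \<open>s\<close> with unit vectors, cut off so that
    the components vanish wherever \<open>s\<close> does.\<close>
  have "rep UNIV s (\<lambda>l e. if e = l \<and> s e \<noteq> 0 then 1 else 0)"
  proof -
    have "s e = (\<Sum>l\<in>UNIV. s l * (if e = l \<and> s e \<noteq> 0 then 1 else 0))" for e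
      by (cases "s e = 0") (simp_all add: if_distrib[of "\<lambda>u. _ * u"] cong: if_cong)
    then show ?thesis using A(1,2) by (simp add: rep_def)
  qed
  then have ex: "\<exists>n I b \<tau>. rep I b \<tau> \<and> card I = n" by blast
  define n where "n = (LEAST n. \<exists>I b \<tau>. rep I b \<tau> \<and> card I = n)"
  obtain I b \<tau> where r: "rep I b \<tau>" "card I = n"
    using LeastI_ex[OF ex] unfolding n_def by blast
  have min: "n \<le> card J" if "rep J c \<rho>" for J c \<rho>
    unfolding n_def by (rule Least_le) (use that in blast)
  show ?thesis
  proof (intro exI conjI)
    show "\<forall>e. s e = (\<Sum>l\<in>I. b l * \<tau> l e)" "\<forall>l e. \<tau> l e \<in> A" "\<forall>l e. s e = 0 \<longrightarrow> \<tau> l e = 0"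
      using r(1) unfolding rep_def by blast+
    show "\<forall>a. (\<forall>l. a l \<in> A) \<longrightarrow> (\<Sum>l\<in>I. b l * a l) = 0 \<longrightarrow> (\<forall>l\<in>I. a l = 0)"
    proof (intro allI impI ballI, rule ccontr)
      fix a l assume a: "\<forall>l. a l \<in> A" and dep: "(\<Sum>l\<in>I. b l * a l) = 0" and l: "l \<in> I"
        and nz: "a l \<noteq> 0"
      have bl: "(\<Sum>k\<in>I - {l}. b k * a k) = - (b l * a l)"
        using dep l by (simp add: sum.remove[of I l])
      \<comment> \<open>The dependence eliminates \<open>b l\<close>. As \<open>a l\<close> may lack
        an inverse in \<open>A\<close>, the components are multiplied by it and the coefficients
        \<open>b k\<close> divided by it.\<close>
      have "rep (I - {l}) (\<lambda>k. b k / a l) (\<lambda>k e. a l * \<tau> k e - a k * \<tau> l e)"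
        unfolding rep_def
      proof (intro conjI allI impI)
        fix e
        have "(\<Sum>k\<in>I - {l}. b k / a l * (a l * \<tau> k e - a k * \<tau> l e)) =
            (\<Sum>k\<in>I - {l}. b k * \<tau> k e) - (\<Sum>k\<in>I - {l}. b k * a k) * \<tau> l e / a l"
          using nz by (simp add: sum_subtractf[symmetric] sum_distrib_right sum_divide_distrib
              right_diff_distrib mult.assoc)
        also have "\<dots> = (\<Sum>k\<in>I. b k * \<tau> k e)"
          using l nz unfolding bl by (simp add: sum.remove[of I l])
        also have "\<dots> = s e" using r(1) by (simp add: rep_def)
        finally show "s e = (\<Sum>k\<in>I - {l}. b k / a l * (a l * \<tau> k e - a k * \<tau> l e))" by simp
      qed (use r(1) a A in \<open>auto simp: rep_def\<close>)
      from min[OF this] r(2) l show False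
        by (metis card_Diff1_less finite not_less)
    qed
  qed
qed

section \<open>Stresses of equivalent frameworks\<close>

text \<open>The weights live on ordered pairs, so double sums over vertices replace sums over edges
  and count each edge twice.\<close>

definition laplacian :: "('v::finite \<Rightarrow> 'v \<Rightarrow> real) \<Rightarrow> ('v \<Rightarrow> real) \<Rightarrow> 'v \<Rightarrow> real" where
  "laplacian s f v = (\<Sum>u\<in>UNIV. s v u * (f v - f u))"

text \<open>Summation by parts: by symmetry of \<open>s\<close>, exchanging the ends of an edge
  turns the terms in \<open>w u\<close> into those in \<open>w v\<close>.\<close>

lemma laplacian_form:
  assumes "\<And>v u. s v u = s u v"
  shows "(\<Sum>v\<in>UNIV. \<Sum>u\<in>UNIV. s v u * ((f v - f u) * (w v - w u))) = 2 * (\<Sum>v\<in>UNIV. w v * laplacian s f v)"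
proof -
  let ?A = "\<Sum>v\<in>UNIV. \<Sum>u\<in>UNIV. s v u * ((f v - f u) * w v)"
  have "(\<Sum>v\<in>UNIV. \<Sum>u\<in>UNIV. s v u * ((f v - f u) * w u)) = (\<Sum>u\<in>UNIV. \<Sum>v\<in>UNIV. s v u * ((f v - f u) * w u))"
    by (rule sum.swap)
  also have "\<dots> = (\<Sum>u\<in>UNIV. \<Sum>v\<in>UNIV. - (s u v * ((f u - f v) * w u)))"
    by (intro sum.cong refl) (simp add: assms[of u v for u v] algebra_simps)
  finally have "(\<Sum>v\<in>UNIV. \<Sum>u\<in>UNIV. s v u * ((f v - f u) * w u)) = - ?A"
    by (simp add: sum_negf)
  moreover have "?A = (\<Sum>v\<in>UNIV. w v * laplacian s f v)"
    by (simp add: laplacian_def sum_distrib_left mult_ac)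
  moreover have "(\<Sum>v\<in>UNIV. \<Sum>u\<in>UNIV. s v u * ((f v - f u) * (w v - w u))) =
      ?A - (\<Sum>v\<in>UNIV. \<Sum>u\<in>UNIV. s v u * ((f v - f u) * w u))"
    by (simp add: right_diff_distrib sum_subtractf)
  ultimately show ?thesis by simp
qed

text \<open>\<open>stress\<close> and \<open>ortho\<close> express the two column blocks of the
  kernel condition through ordered pairs.\<close>

context
  fixes x :: "'v::finite \<times> ('m::finite + 'k::finite) \<Rightarrow> real" and s :: "'v \<Rightarrow> 'v \<Rightarrow> real"
  assumes x: "alg_independent_rat x"
    and s: "\<And>v u. s v u = s u v"
    and stress: "\<And>i. laplacian s (\<lambda>v. x (v, Inl i)) = (\<lambda>_. 0)"
    and ortho: "\<And>j. (\<Sum>v\<in>UNIV. \<Sum>u\<in>UNIV. s v u * (x (v, Inr j) - x (u, Inr j))\<^sup>2) = 0"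
begin

text \<open>The squared edge lengths of \<open>x\<close> and \<open>q\<close> agree only up to the unknown multiples \<open>\<gamma>\<close>. Expanding \<open>s\<close> over
  the ring \<open>A\<close> of polynomials in the last coordinates splits the orthogonality to these multiples into
  conditions on the components \<open>\<tau>\<close>, so that each \<open>H l\<close> takes the same value at \<open>x\<close> and at \<open>q\<close>. A derivation
  that kills the last coordinates and sends \<open>H l x\<close> to the derivative of \<open>H l\<close> at \<open>q\<close> in direction \<open>w\<close>
  turns the equilibrium of \<open>x\<close> into that of \<open>q\<close>.\<close>

lemma stress_of_equivalent:
  fixes q :: "'v \<Rightarrow> 'm \<Rightarrow> real" and \<gamma> :: "'k \<Rightarrow> real"
  assumes q: "\<And>v u. s v u \<noteq> 0 \<Longrightarrow>
      (\<Sum>i\<in>UNIV. (q v i - q u i)\<^sup>2) + (\<Sum>j\<in>UNIV. \<gamma> j * (x (v, Inr j) - x (u, Inr j))\<^sup>2) =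
      (\<Sum>i\<in>UNIV. (x (v, Inl i) - x (u, Inl i))\<^sup>2)"
  shows "(\<Sum>v\<in>UNIV. \<Sum>u\<in>UNIV. s v u * (\<Sum>i\<in>UNIV. (q v i - q u i) * (w v i - w u i))) = 0"
proof -
  \<comment> \<open>A semantic substitute for involving only the last coordinates: it lets values at
    \<open>x\<close> pass to any configuration with the same last coordinates.\<close>
  define last_only where "last_only F \<longleftrightarrow>
      ratpoly F \<and> (\<forall>y. (\<forall>v j. y (v, Inr j) = x (v, Inr j)) \<longrightarrow> F y = F x)" for F
  define A where "A = (\<lambda>F. F x) ` Collect last_only"
  have A: "F x \<in> A" if "last_only F" for F
    unfolding A_def using that by simp
  have A0: "0 \<in> A" using A[of "\<lambda>_. 0"] by (simp add: last_only_def ratpoly_0)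
  have A1: "1 \<in> A" using A[of "\<lambda>_. 1"] by (simp add: last_only_def ratpoly_1)
  have Adiff: "a - b \<in> A" and Amult: "a * b \<in> A" if ab: "a \<in> A" "b \<in> A" for a b
  proof -
    obtain F G where F: "last_only F" "a = F x" and G: "last_only G" "b = G x"
      using ab by (auto simp: A_def)
    have FG: "ratpoly F" "ratpoly G"
      "(\<forall>v j. y (v, Inr j) = x (v, Inr j)) \<Longrightarrow> F y = F x \<and> G y = G x" for y
      using F(1) G(1) unfolding last_only_def by blast+
    have "last_only (\<lambda>y. F y - G y)" "last_only (\<lambda>y. F y * G y)"
      unfolding last_only_def
      by (intro conjI ratpoly_diff ratpoly_mult FG(1,2); auto dest!: FG(3))+
    from this[THEN A] show "a - b \<in> A" "a * b \<in> A" by (simp_all add: F(2) G(2))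
  qed
  have Asquare: "(x (v, Inr j) - x (u, Inr j))\<^sup>2 \<in> A" for v u j
    by (rule A[of "\<lambda>y. (y (v, Inr j) - y (u, Inr j))\<^sup>2"]) (unfold last_only_def, intro conjI ratpoly_power ratpoly_diff ratpoly_var, simp)
  have Asum: "(\<Sum>a\<in>B. f a) \<in> A" if "\<And>a. f a \<in> A" for f :: "'v \<Rightarrow> real" and B
  proof (induction B rule: infinite_finite_induct)
    case (insert a B)
    have "f a - (0 - sum f B) \<in> A" by (intro Adiff that A0 insert.IH)
    with insert.hyps show ?case by simp
  qed (auto simp: A0)

  have "\<forall>a\<in>A. \<forall>b\<in>A. a - b \<in> A" "\<forall>a\<in>A. \<forall>b\<in>A. a * b \<in> A"
    using Adiff Amult by blast+
  from decomposition_over_subring[OF A0 A1 this, of "case_prod s"]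
  obtain I :: "('v \<times> 'v) set" and b \<tau>' where
    dec': "\<forall>e. case_prod s e = (\<Sum>l\<in>I. b l * \<tau>' l e)" "\<forall>l e. \<tau>' l e \<in> A"
      "\<forall>l e. case_prod s e = 0 \<longrightarrow> \<tau>' l e = 0"
    and indep: "\<forall>a. (\<forall>l. a l \<in> A) \<longrightarrow> (\<Sum>l\<in>I. b l * a l) = 0 \<longrightarrow> (\<forall>l\<in>I. a l = 0)"
    by (elim exE conjE) (rule that)
  define \<tau> where "\<tau> l v u = \<tau>' l (v, u)" for l v u
  have dec: "s v u = (\<Sum>l\<in>I. b l * \<tau> l v u)" "\<tau> l v u \<in> A" "s v u = 0 \<Longrightarrow> \<tau> l v u = 0" for l v u
    using dec'(1)[rule_format, of "(v, u)"] dec'(2)[rule_format, of l "(v, u)"]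
      dec'(3)[rule_format, of "(v, u)" l] by (simp_all add: \<tau>_def)
  have expand: "(\<Sum>v\<in>UNIV. \<Sum>u\<in>UNIV. s v u * c v u) = (\<Sum>l\<in>I. b l * (\<Sum>v\<in>UNIV. \<Sum>u\<in>UNIV. \<tau> l v u * c v u))"
    for c
  proof -
    have "(\<Sum>v\<in>UNIV. \<Sum>u\<in>UNIV. s v u * c v u) = (\<Sum>v\<in>UNIV. \<Sum>u\<in>UNIV. \<Sum>l\<in>I. b l * (\<tau> l v u * c v u))"
      by (simp add: dec(1) sum_distrib_right mult.assoc)
    also have "\<dots> = (\<Sum>v\<in>UNIV. \<Sum>l\<in>I. \<Sum>u\<in>UNIV. b l * (\<tau> l v u * c v u))"
      by (intro sum.cong refl sum.swap)
    also have "\<dots> = (\<Sum>l\<in>I. \<Sum>v\<in>UNIV. \<Sum>u\<in>UNIV. b l * (\<tau> l v u * c v u))"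
      by (rule sum.swap)
    finally show ?thesis by (simp add: sum_distrib_left)
  qed
  have ortho_\<tau>: "(\<Sum>v\<in>UNIV. \<Sum>u\<in>UNIV. \<tau> l v u * (x (v, Inr j) - x (u, Inr j))\<^sup>2) = 0" if "l \<in> I" for l j
    by (rule indep[rule_format, OF _ _ that])
      (intro Asum Amult dec(2) Asquare, simp only: expand[symmetric] ortho)
  have "\<exists>F. last_only F \<and> \<tau> l v u = F x" for l v u
    using dec(2)[of l v u] by (auto simp: A_def)
  then obtain F where F0: "\<And>l v u. last_only (F l v u)" "\<And>l v u. \<tau> l v u = F l v u x"
    by metis
  have F: "ratpoly (F l v u)" "\<tau> l v u = F l v u x" for l v u
    using F0[of l v u] unfolding last_only_def by blast+
  have F\<tau>: "F l v u y = \<tau> l v u" if "\<And>v j. y (v, Inr j) = x (v, Inr j)" for l v u y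
  proof -
    have "F l v u y = F l v u x"
      using F0(1)[of l v u] that unfolding last_only_def by blast
    then show ?thesis by (simp add: F0(2))
  qed

  \<comment> \<open>\<open>q'\<close> keeps the last coordinates of \<open>x\<close>, the rescaling
    being absorbed in \<open>\<gamma>\<close>; \<open>w'\<close> moves only the first
    coordinates.\<close>
  define q' where "q' = (\<lambda>(v, c). case c of Inl i \<Rightarrow> q v i | Inr j \<Rightarrow> x (v, Inr j))"
  define w' where "w' = (\<lambda>(v, c). case c of Inl i \<Rightarrow> w v i | Inr (j::'k) \<Rightarrow> 0)"
  have F': "F l v u (\<lambda>c. q' c + t * w' c) = \<tau> l v u" "F l v u q' = \<tau> l v u" for l v u t
    by (rule F\<tau>, simp add: q'_def w'_def)+
  obtain D where "real_derivation D" and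
    D: "\<And>F d. ratpoly F \<Longrightarrow> F q' = F x \<Longrightarrow>
       ((\<lambda>t. F (\<lambda>i. q' i + t * w' i)) has_real_derivative d) (at 0) \<Longrightarrow> D (F x) = d"
    using generic_derivation[OF x, of q' w'] by blast
  interpret real_derivation D by fact
  \<comment> \<open>Along the line through \<open>q'\<close> in direction \<open>w'\<close> the
    polynomial \<open>F l v u\<close> is constant.\<close>
  have D\<tau>: "D (\<tau> l v u) = 0" for l v u
    using D[OF F(1), of l v u 0] F' by (simp add: F(2)[symmetric])

  define H where "H l y = (\<Sum>v\<in>UNIV. \<Sum>u\<in>UNIV. F l v u y * (\<Sum>i\<in>UNIV. (y (v, Inl i) - y (u, Inl i))\<^sup>2))" for l y
  have H: "ratpoly (H l)" for l
    unfolding H_def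
    by (intro ratpoly_sum ratpoly_mult F(1) ratpoly_power ratpoly_diff ratpoly_var)
  have Hx: "H l x = (\<Sum>v\<in>UNIV. \<Sum>u\<in>UNIV. \<tau> l v u * (\<Sum>i\<in>UNIV. (x (v, Inl i) - x (u, Inl i))\<^sup>2))" for l
    by (simp add: H_def F(2))
  have Hq: "H l q' = H l x" if "l \<in> I" for l
  proof -
    have "\<tau> l v u * (\<Sum>i\<in>UNIV. (x (v, Inl i) - x (u, Inl i))\<^sup>2) = \<tau> l v u * (\<Sum>i\<in>UNIV. (q v i - q u i)\<^sup>2)
        + (\<Sum>j\<in>UNIV. \<gamma> j * (\<tau> l v u * (x (v, Inr j) - x (u, Inr j))\<^sup>2))" for v u
    proof (cases "s v u = 0")
      case True
      then show ?thesis by (simp add: dec(3))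
    next
      case False
      show ?thesis
        unfolding q[OF False, symmetric] by (simp add: distrib_left sum_distrib_left mult_ac)
    qed
    then have "H l x = (\<Sum>v\<in>UNIV. \<Sum>u\<in>UNIV. \<tau> l v u * (\<Sum>i\<in>UNIV. (q v i - q u i)\<^sup>2))
        + (\<Sum>v\<in>UNIV. \<Sum>u\<in>UNIV. \<Sum>j\<in>UNIV. \<gamma> j * (\<tau> l v u * (x (v, Inr j) - x (u, Inr j))\<^sup>2))"
      by (simp add: Hx sum.distrib)
    also have "(\<Sum>v\<in>UNIV. \<Sum>u\<in>UNIV. \<Sum>j\<in>UNIV. \<gamma> j * (\<tau> l v u * (x (v, Inr j) - x (u, Inr j))\<^sup>2)) =
        (\<Sum>v\<in>UNIV. \<Sum>j\<in>UNIV. \<Sum>u\<in>UNIV. \<gamma> j * (\<tau> l v u * (x (v, Inr j) - x (u, Inr j))\<^sup>2))"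
      by (intro sum.cong refl sum.swap)
    also have "\<dots> = (\<Sum>j\<in>UNIV. \<Sum>v\<in>UNIV. \<Sum>u\<in>UNIV. \<gamma> j * (\<tau> l v u * (x (v, Inr j) - x (u, Inr j))\<^sup>2))"
      by (rule sum.swap)
    also have "\<dots> = 0"
      using ortho_\<tau>[OF that] by (simp add: sum_distrib_left[symmetric])
    finally have "H l x = (\<Sum>v\<in>UNIV. \<Sum>u\<in>UNIV. \<tau> l v u * (\<Sum>i\<in>UNIV. (q v i - q u i)\<^sup>2))"
      by simp
    moreover have "H l q' = (\<Sum>v\<in>UNIV. \<Sum>u\<in>UNIV. \<tau> l v u * (\<Sum>i\<in>UNIV. (q v i - q u i)\<^sup>2))"
      unfolding H_def F' by (simp add: q'_def)
    ultimately show ?thesis by simp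
  qed
  have "(\<Sum>v\<in>UNIV. \<Sum>u\<in>UNIV. \<tau> l v u * (\<Sum>i\<in>UNIV. (q v i - q u i) * (w v i - w u i))) =
      (\<Sum>v\<in>UNIV. \<Sum>u\<in>UNIV. \<tau> l v u *
        (\<Sum>i\<in>UNIV. (x (v, Inl i) - x (u, Inl i)) * (D (x (v, Inl i)) - D (x (u, Inl i)))))"
    if "l \<in> I" for l
  proof -
    have "((\<lambda>t. H l (\<lambda>i. q' i + t * w' i)) has_real_derivative
        (\<Sum>v\<in>UNIV. \<Sum>u\<in>UNIV. \<tau> l v u * (\<Sum>i\<in>UNIV. 2 * ((q v i - q u i) * (w v i - w u i))))) (at 0)"
      unfolding H_def F'
      by (auto simp: q'_def w'_def intro!: derivative_eq_intros sum.cong)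
    from D[OF H Hq[OF that] this]
    have "D (H l x) = (\<Sum>v\<in>UNIV. \<Sum>u\<in>UNIV. \<tau> l v u * (\<Sum>i\<in>UNIV. 2 * ((q v i - q u i) * (w v i - w u i))))" .
    moreover have "D (H l x) = (\<Sum>v\<in>UNIV. \<Sum>u\<in>UNIV. \<tau> l v u *
        (\<Sum>i\<in>UNIV. 2 * ((x (v, Inl i) - x (u, Inl i)) * (D (x (v, Inl i)) - D (x (u, Inl i))))))"
      by (simp add: Hx sum mult square diff D\<tau>)
    ultimately have "2 * (\<Sum>v\<in>UNIV. \<Sum>u\<in>UNIV. \<tau> l v u * (\<Sum>i\<in>UNIV. (q v i - q u i) * (w v i - w u i))) =
      2 * (\<Sum>v\<in>UNIV. \<Sum>u\<in>UNIV. \<tau> l v u *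
        (\<Sum>i\<in>UNIV. (x (v, Inl i) - x (u, Inl i)) * (D (x (v, Inl i)) - D (x (u, Inl i)))))"
      unfolding sum_distrib_left by (simp add: mult_ac)
    then show ?thesis by simp
  qed
  then have "(\<Sum>v\<in>UNIV. \<Sum>u\<in>UNIV. s v u * (\<Sum>i\<in>UNIV. (q v i - q u i) * (w v i - w u i))) =
      (\<Sum>v\<in>UNIV. \<Sum>u\<in>UNIV. s v u *
        (\<Sum>i\<in>UNIV. (x (v, Inl i) - x (u, Inl i)) * (D (x (v, Inl i)) - D (x (u, Inl i)))))"
    unfolding expand by simp
  \<comment> \<open>The numbers \<open>D (x (v, Inl i))\<close> now serve as a test direction
    against the equilibrium of \<open>x\<close>.\<close>
  also have "\<dots> = (\<Sum>v\<in>UNIV. \<Sum>i\<in>UNIV. \<Sum>u\<in>UNIV. s v u *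
        ((x (v, Inl i) - x (u, Inl i)) * (D (x (v, Inl i)) - D (x (u, Inl i)))))"
    unfolding sum_distrib_left by (intro sum.cong refl sum.swap)
  also have "\<dots> = (\<Sum>i\<in>UNIV. \<Sum>v\<in>UNIV. \<Sum>u\<in>UNIV. s v u *
        ((x (v, Inl i) - x (u, Inl i)) * (D (x (v, Inl i)) - D (x (u, Inl i)))))"
    by (rule sum.swap)
  also have "\<dots> = 0"
    by (simp add: laplacian_form[OF s, where f = "\<lambda>v. x (v, Inl i)" and w = "\<lambda>v. D (x (v, Inl i))" for i] stress)
  finally show ?thesis .
qed

text \<open>Testing with the direction that moves a single coordinate of a single vertex isolates
  one equilibrium equation.\<close>

lemma laplacian_of_equivalent:
  fixes q :: "'v \<Rightarrow> 'm \<Rightarrow> real" and \<gamma> :: "'k \<Rightarrow> real"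
  assumes q: "\<And>v u. s v u \<noteq> 0 \<Longrightarrow>
      (\<Sum>i\<in>UNIV. (q v i - q u i)\<^sup>2) + (\<Sum>j\<in>UNIV. \<gamma> j * (x (v, Inr j) - x (u, Inr j))\<^sup>2) =
      (\<Sum>i\<in>UNIV. (x (v, Inl i) - x (u, Inl i))\<^sup>2)"
  shows "laplacian s (\<lambda>v. q v i) v = 0"
proof -
  define w where "w = (\<lambda>u c. if u = v \<and> c = i then 1 else 0 :: real)"
  have "(\<Sum>c\<in>UNIV. (q a c - q b c) * (w a c - w b c)) = (q a i - q b i) * (w a i - w b i)" for a b
  proof -
    have "(\<Sum>c\<in>UNIV. (q a c - q b c) * (w a c - w b c)) =
        (\<Sum>c\<in>UNIV. if c = i then (q a i - q b i) * (w a i - w b i) else 0)"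
      by (rule sum.cong) (simp_all add: w_def)
    then show ?thesis by simp
  qed
  with stress_of_equivalent[OF q, of w]
  have "(\<Sum>a\<in>UNIV. \<Sum>b\<in>UNIV. s a b * ((q a i - q b i) * (w a i - w b i))) = 0" by simp
  then have "(\<Sum>a\<in>UNIV. w a i * laplacian s (\<lambda>v. q v i) a) = 0"
    using laplacian_form[OF s, where f = "\<lambda>v. q v i" and w = "\<lambda>v. w v i"] by simp
  then show ?thesis by (simp add: w_def if_distrib[of "\<lambda>u. u * _"] cong: if_cong)
qed

text \<open>Differentiating the conditions on \<open>s\<close> along a derivation \<open>D\<close> that kills the first coordinates and
  has arbitrary values at the last ones shows that \<open>D s\<close> is again in equilibrium with the first coordinates
  and pairs with the last ones as \<open>- 2 s\<close> does with their derivatives.\<close>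

lemma quadratic_relation_coeff:
  fixes Q :: "'m \<Rightarrow> 'm \<Rightarrow> real" and \<gamma> :: "'k \<Rightarrow> real"
  assumes rel: "\<And>v u. s v u \<noteq> 0 \<Longrightarrow>
      (\<Sum>i\<in>UNIV. \<Sum>j\<in>UNIV. Q i j * ((x (v, Inl i) - x (u, Inl i)) * (x (v, Inl j) - x (u, Inl j)))) +
      (\<Sum>j\<in>UNIV. \<gamma> j * (x (v, Inr j) - x (u, Inr j))\<^sup>2) = 0"
  shows "\<gamma> k * laplacian s (\<lambda>v. x (v, Inr k)) v = 0"
proof -
  define w :: "'v \<times> ('m + 'k) \<Rightarrow> real" where "w = (\<lambda>c. if c = (v, Inr k) then 1 else 0)"
  \<comment> \<open>Taking \<open>q = x\<close> makes the condition \<open>F q = F x\<close> void,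
    so \<open>D\<close> has the prescribed value \<open>w c\<close> at each coordinate
    \<open>x c\<close>.\<close>
  obtain D where "real_derivation D" and
    D: "\<And>F d. ratpoly F \<Longrightarrow> F x = F x \<Longrightarrow>
       ((\<lambda>t. F (\<lambda>i. x i + t * w i)) has_real_derivative d) (at 0) \<Longrightarrow> D (F x) = d"
    using generic_derivation[OF x, of x w] by blast
  interpret real_derivation D by fact
  have Dx: "D (x c) = w c" for c
  proof -
    have "((\<lambda>t. x c + t * w c) has_real_derivative w c) (at 0)"
      by (auto intro!: derivative_eq_intros)
    from D[OF ratpoly_var refl this] show ?thesis .
  qed
  have Dx0: "D (x (u, Inl i)) = 0" for u i
    by (simp add: Dx w_def)
  define s' where "s' = (\<lambda>v u. D (s v u))"
  have s': "s' v u = s' u v" for v u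
    by (simp add: s'_def s[of v u])
  have stress': "laplacian s' (\<lambda>v. x (v, Inl i)) = (\<lambda>_. 0)" for i
  proof
    fix v
    have "D (laplacian s (\<lambda>v. x (v, Inl i)) v) = laplacian s' (\<lambda>v. x (v, Inl i)) v"
      by (simp add: laplacian_def sum mult diff Dx0 s'_def)
    then show "laplacian s' (\<lambda>v. x (v, Inl i)) v = 0" by (simp add: stress zero)
  qed
  let ?y = "\<lambda>j v u. x (v, Inr j) - x (u, Inr j)"
  let ?w = "\<lambda>j v u. w (v, Inr j) - w (u, Inr j)"
  have ortho': "(\<Sum>v\<in>UNIV. \<Sum>u\<in>UNIV. s' v u * (?y j v u)\<^sup>2) =
      - 2 * (\<Sum>v\<in>UNIV. \<Sum>u\<in>UNIV. s v u * (?y j v u * ?w j v u))" for j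
  proof -
    have "D (\<Sum>v\<in>UNIV. \<Sum>u\<in>UNIV. s v u * (?y j v u)\<^sup>2) =
        (\<Sum>v\<in>UNIV. \<Sum>u\<in>UNIV. s v u * (2 * (?y j v u * ?w j v u)) + s' v u * (?y j v u)\<^sup>2)"
      by (simp add: sum mult square diff Dx s'_def)
    then have "0 = (\<Sum>v\<in>UNIV. \<Sum>u\<in>UNIV. s v u * (2 * (?y j v u * ?w j v u)) + s' v u * (?y j v u)\<^sup>2)"
      by (simp add: ortho zero)
    also have "\<dots> = 2 * (\<Sum>v\<in>UNIV. \<Sum>u\<in>UNIV. s v u * (?y j v u * ?w j v u)) + (\<Sum>v\<in>UNIV. \<Sum>u\<in>UNIV. s' v u * (?y j v u)\<^sup>2)"
      by (simp add: sum.distrib sum_distrib_left mult_ac)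
    finally show ?thesis by simp
  qed
  let ?R = "\<lambda>v u. \<Sum>i\<in>UNIV. \<Sum>j\<in>UNIV. Q i j * ((x (v, Inl i) - x (u, Inl i)) * (x (v, Inl j) - x (u, Inl j)))"
  \<comment> \<open>\<open>D s\<close> vanishes where \<open>s\<close> does, so the relation, known
    on the support of \<open>s\<close>, can be paired with \<open>D s\<close>.\<close>
  have "s' v u * (?R v u + (\<Sum>j\<in>UNIV. \<gamma> j * (?y j v u)\<^sup>2)) = 0" for v u
    using rel[of v u] by (cases "s v u = 0") (auto simp: s'_def zero)
  then have "(\<Sum>v\<in>UNIV. \<Sum>u\<in>UNIV. s' v u * ?R v u + s' v u * (\<Sum>j\<in>UNIV. \<gamma> j * (?y j v u)\<^sup>2)) = 0"
    by (simp add: distrib_left)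
  then have split: "(\<Sum>v\<in>UNIV. \<Sum>u\<in>UNIV. s' v u * ?R v u) +
      (\<Sum>v\<in>UNIV. \<Sum>u\<in>UNIV. s' v u * (\<Sum>j\<in>UNIV. \<gamma> j * (?y j v u)\<^sup>2)) = 0"
    by (simp add: sum.distrib)
  have swap: "(\<Sum>v\<in>UNIV. \<Sum>u\<in>UNIV. \<Sum>j\<in>UNIV. g v u j) = (\<Sum>j\<in>UNIV. \<Sum>v\<in>UNIV. \<Sum>u\<in>UNIV. g v u j)"
    for g :: "'v \<Rightarrow> 'v \<Rightarrow> 'j::finite \<Rightarrow> real"
  proof -
    have "(\<Sum>v\<in>UNIV. \<Sum>u\<in>UNIV. \<Sum>j\<in>UNIV. g v u j) = (\<Sum>v\<in>UNIV. \<Sum>j\<in>UNIV. \<Sum>u\<in>UNIV. g v u j)"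
      by (intro sum.cong refl sum.swap)
    also have "\<dots> = (\<Sum>j\<in>UNIV. \<Sum>v\<in>UNIV. \<Sum>u\<in>UNIV. g v u j)" by (rule sum.swap)
    finally show ?thesis .
  qed
  \<comment> \<open>Summation by parts and the equilibrium of \<open>s'\<close> remove the quadratic
    form.\<close>
  have "(\<Sum>v\<in>UNIV. \<Sum>u\<in>UNIV. s' v u * ?R v u) = (\<Sum>i\<in>UNIV. \<Sum>j\<in>UNIV. Q i j *
      (\<Sum>v\<in>UNIV. \<Sum>u\<in>UNIV. s' v u * ((x (v, Inl i) - x (u, Inl i)) * (x (v, Inl j) - x (u, Inl j)))))"
    unfolding sum_distrib_left
    by (subst swap, intro sum.cong refl, subst swap, intro sum.cong refl) simp
  also have "\<dots> = 0"
    by (simp add: laplacian_form[OF s', where f = "\<lambda>v. x (v, Inl i)" and w = "\<lambda>v. x (v, Inl j)" for i j] stress')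
  finally have "(\<Sum>v\<in>UNIV. \<Sum>u\<in>UNIV. s' v u * (\<Sum>j\<in>UNIV. \<gamma> j * (?y j v u)\<^sup>2)) = 0"
    using split by simp
  moreover have "(\<Sum>v\<in>UNIV. \<Sum>u\<in>UNIV. s' v u * (\<Sum>j\<in>UNIV. \<gamma> j * (?y j v u)\<^sup>2)) =
      (\<Sum>j\<in>UNIV. \<gamma> j * (\<Sum>v\<in>UNIV. \<Sum>u\<in>UNIV. s' v u * (?y j v u)\<^sup>2))"
    unfolding sum_distrib_left by (subst swap, intro sum.cong refl) simp
  ultimately have "(\<Sum>j\<in>UNIV. \<gamma> j * (\<Sum>v\<in>UNIV. \<Sum>u\<in>UNIV. s v u * (?y j v u * ?w j v u))) = 0"
  proof -
    define T where "T j = (\<Sum>v\<in>UNIV. \<Sum>u\<in>UNIV. s v u * (?y j v u * ?w j v u))" for j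
    assume "(\<Sum>v\<in>UNIV. \<Sum>u\<in>UNIV. s' v u * (\<Sum>j\<in>UNIV. \<gamma> j * (?y j v u)\<^sup>2)) = 0"
      and "(\<Sum>v\<in>UNIV. \<Sum>u\<in>UNIV. s' v u * (\<Sum>j\<in>UNIV. \<gamma> j * (?y j v u)\<^sup>2)) =
        (\<Sum>j\<in>UNIV. \<gamma> j * (\<Sum>v\<in>UNIV. \<Sum>u\<in>UNIV. s' v u * (?y j v u)\<^sup>2))"
    then have "0 = (\<Sum>j\<in>UNIV. \<gamma> j * (- 2 * T j))"
      unfolding ortho' T_def by argo
    also have "\<dots> = - 2 * (\<Sum>j\<in>UNIV. \<gamma> j * T j)"
      unfolding sum_distrib_left by (simp add: mult_ac)
    finally show ?thesis by (simp add: T_def)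
  qed
  then have "(\<Sum>j\<in>UNIV. \<gamma> j * (2 * (\<Sum>a\<in>UNIV. w (a, Inr j) * laplacian s (\<lambda>v. x (v, Inr j)) a))) = 0"
    using laplacian_form[OF s, where f = "\<lambda>v. x (v, Inr j)" and w = "\<lambda>v. w (v, Inr j)" for j] by simp
  moreover have "(\<Sum>a\<in>UNIV. w (a, Inr j) * laplacian s (\<lambda>v. x (v, Inr j)) a) =
      (if j = k then laplacian s (\<lambda>v. x (v, Inr k)) v else 0)" for j
    by (cases "j = k") (simp_all add: w_def if_distrib[of "\<lambda>u. u * _"] cong: if_cong)
  ultimately show ?thesis
    by (simp add: if_distrib[of "\<lambda>u. _ * u"] cong: if_cong)
qed

end

section \<open>Global rigidity\<close>

lemma laplacian_affine:
  "laplacian s (\<lambda>v. a + (\<Sum>i\<in>B. b i * f i v)) v = (\<Sum>i\<in>B. b i * laplacian s (f i) v)"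
proof -
  have "laplacian s (\<lambda>v. a + (\<Sum>i\<in>B. b i * f i v)) v = (\<Sum>u\<in>UNIV. \<Sum>i\<in>B. b i * (s v u * (f i v - f i u)))"
    unfolding laplacian_def
    by (intro sum.cong refl) (simp add: sum_subtractf[symmetric] sum_distrib_left algebra_simps)
  also have "\<dots> = (\<Sum>i\<in>B. \<Sum>u\<in>UNIV. b i * (s v u * (f i v - f i u)))"
    by (rule sum.swap)
  finally show ?thesis by (simp add: laplacian_def sum_distrib_left)
qed

text \<open>Affine functions of the first coordinates form a subspace of the kernel of dimension
  \<open>CARD('m) + 1\<close>, and the rank condition leaves no room for more.\<close>

lemma laplacian_kernel:
  fixes x :: "'v::finite \<times> ('m::finite + 'k::finite) \<Rightarrow> real" and A :: "real^'v^'v"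
  assumes x: "alg_independent_rat x"
    and A: "\<And>f. A *v f = (\<chi> v. laplacian s (\<lambda>u. f $ u) v)"
    and rank: "rank A + CARD('m) + 1 = CARD('v)"
    and stress: "\<And>i. laplacian s (\<lambda>v. x (v, Inl i)) = (\<lambda>_. 0)"
    and f: "laplacian s f = (\<lambda>_. 0)"
  shows "\<exists>a b. \<forall>v. f v = a + (\<Sum>i\<in>UNIV. b i * x (v, Inl i))"
proof -
  define K where "K = {z. A *v z = 0}"
  define T where "T c = (\<chi> v. c $ None + (\<Sum>i\<in>UNIV. c $ Some i * x (v, Inl i)))" for c :: "real^'m option"
  have "linear T"
    by (rule linearI)
      (simp_all add: T_def vec_eq_iff sum.distrib distrib_right distrib_left sum_distrib_left mult_ac)
  have "inj T"
    unfolding linear_injective_0[OF \<open>linear T\<close>]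
  proof (intro allI impI)
    fix c assume "T c = 0"
    then have eq: "c $ None + (\<Sum>i\<in>range Inl. c $ Some (projl i) * x (v, i)) = 0" for v
      by (simp add: T_def vec_eq_iff sum.reindex)
    have "card (range (Inl :: 'm \<Rightarrow> 'm + 'k)) < card (UNIV :: 'v set)"
      using rank by (simp add: card_image)
    note generic_affine_functions_independent[OF x this eq]
    then have "c $ k = 0" for k
      by (cases k) force+
    then show "c = 0" by (simp add: vec_eq_iff)
  qed
  have "range T \<subseteq> K"
  proof
    fix z assume "z \<in> range T"
    then obtain c where "z = T c" by blast
    then have "(\<lambda>u. z $ u) = (\<lambda>v. c $ None + (\<Sum>i\<in>UNIV. c $ Some i * x (v, Inl i)))"
      by (simp add: T_def)
    then show "z \<in> K"
      unfolding K_def A by (simp add: laplacian_affine stress vec_eq_iff)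
  qed
  have "dim (range T) = CARD('m) + 1"
    using dim_image_eq[OF \<open>linear T\<close>, of UNIV] \<open>inj T\<close> by (simp add: dim_UNIV)
  \<comment> \<open>Upper bound for the kernel: it is orthogonal to the rows, so its dimension and
    the rank add up to at most \<open>CARD('v)\<close>.\<close>
  have "dim (rows A \<union> K) = rank A + dim K"
    unfolding row_rank_def
  proof (rule dim_orthogonal_sum)
    fix y z assume "y \<in> rows A" "z \<in> K"
    then have "orthogonal z y"
      by (intro orthogonal_nullspace_rowspace) (auto simp: K_def span_base)
    then show "y \<bullet> z = 0" by (simp add: orthogonal_def inner_commute)
  qed
  then have "dim K \<le> dim (range T)"
    using dim_subset_UNIV_cart[of "rows A \<union> K"] rank \<open>dim (range T) = _\<close> by linarith
  with \<open>range T \<subseteq> K\<close> have "span (range T) = span K"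
    by (rule dim_eq_span)
  moreover have "span (range T) = range T"
    using linear_subspace_image[OF \<open>linear T\<close> subspace_UNIV] by (simp only: span_eq_iff)
  moreover have "(\<chi> v. f v) \<in> K"
  proof -
    have eq: "(\<lambda>u. (\<chi> v. f v) $ u) = f" by (simp only: vec_lambda_beta)
    show ?thesis
      unfolding K_def A mem_Collect_eq eq f by (simp add: vec_eq_iff)
  qed
  ultimately have "(\<chi> v. f v) \<in> range T"
    using span_base by metis
  then obtain c where "(\<chi> v. f v) = T c" by blast
  then have "f v = c $ None + (\<Sum>i\<in>UNIV. c $ Some i * x (v, Inl i))" for v
    by (simp add: T_def vec_eq_iff)
  then show ?thesis
    by (intro exI[of _ "c $ None"] exI[of _ "\<lambda>i. c $ Some i"] allI)
qed

section \<open>Matrices of the framework in terms of edge weights\<close>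

lemma sum_neighbours:
  fixes E :: "'v::finite set set" and h :: "'v set \<Rightarrow> real"
  assumes "simple_graph E"
  shows "(\<Sum>u\<in>UNIV. if {v, u} \<in> E then h {v, u} else 0) = (\<Sum>e\<in>E. if v \<in> e then h e else 0)"
proof -
  have eq: "{e \<in> E. v \<in> e} = (\<lambda>u. {v, u}) ` {u. {v, u} \<in> E}"
  proof (intro subset_antisym subsetI)
    fix e assume e: "e \<in> {e \<in> E. v \<in> e}"
    then obtain a b where "e = {a, b}" using assms by (auto simp: simple_graph_def)
    with e have "e = {v, a} \<or> e = {v, b}" by auto
    with e show "e \<in> (\<lambda>u. {v, u}) ` {u. {v, u} \<in> E}" by blast
  qed auto
  have "(\<Sum>u\<in>UNIV. if {v, u} \<in> E then h {v, u} else 0) = (\<Sum>u\<in>{u. {v, u} \<in> E}. h {v, u})"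
    by (simp add: sum.If_cases)
  also have "\<dots> = (\<Sum>e\<in>{e \<in> E. v \<in> e}. h e)"
    unfolding eq by (subst sum.reindex) (auto simp: inj_on_def doubleton_eq_iff)
  also have "\<dots> = (\<Sum>e\<in>E. if v \<in> e then h e else 0)"
    by (rule sum.inter_filter) simp
  finally show ?thesis .
qed

lemma sum_ordered_edges:
  fixes E :: "'v::finite set set" and h :: "'v set \<Rightarrow> real"
  assumes E: "simple_graph E"
  shows "(\<Sum>v\<in>UNIV. \<Sum>u\<in>UNIV. if {v, u} \<in> E then h {v, u} else 0) = 2 * (\<Sum>e\<in>E. h e)"
proof -
  have "(\<Sum>v\<in>UNIV. \<Sum>u\<in>UNIV. if {v, u} \<in> E then h {v, u} else 0) = (\<Sum>e\<in>E. \<Sum>v\<in>UNIV. if v \<in> e then h e else 0)"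
    unfolding sum_neighbours[OF E] by (rule sum.swap)
  also have "\<dots> = (\<Sum>e\<in>E. 2 * h e)"
  proof (rule sum.cong)
    fix e assume "e \<in> E"
    then have "card e = 2" using E by (auto simp: simple_graph_def)
    then show "(\<Sum>v\<in>UNIV. if v \<in> e then h e else 0) = 2 * h e"
      by (simp add: sum.If_cases)
  qed simp
  finally show ?thesis by (simp add: sum_distrib_left)
qed

definition edge_weight :: "'v set set \<Rightarrow> ('v set \<Rightarrow> real) \<Rightarrow> 'v \<Rightarrow> 'v \<Rightarrow> real" where
  "edge_weight E \<sigma> v u = (if {v, u} \<in> E then \<sigma> {v, u} else 0)"

lemma edge_weight_commute: "edge_weight E \<sigma> v u = edge_weight E \<sigma> u v"
  by (simp add: edge_weight_def insert_commute)

lemma simple_graph_no_loop: "simple_graph E \<Longrightarrow> {v, v} \<notin> E"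
  by (auto simp: simple_graph_def doubleton_eq_iff)

lemma stress_matrix_mult:
  assumes "simple_graph E"
  shows "stress_matrix E \<sigma> *v f = (\<chi> v. laplacian (edge_weight E \<sigma>) (\<lambda>u. f $ u) v)"
proof -
  let ?s = "edge_weight E \<sigma>"
  \<comment> \<open>Without loops \<open>?s v v\<close> is 0, so one formula covers diagonal and
    off-diagonal entries.\<close>
  have M: "stress_matrix E \<sigma> $ v $ w = (if v = w then \<Sum>u\<in>UNIV. ?s v u else 0) - ?s v w" for v w
    using simple_graph_no_loop[OF assms, of v]
    by (cases "v = w") (simp_all add: stress_matrix_def edge_weight_def sum.If_cases)
  show ?thesis
    unfolding matrix_vector_mult_def M
    by (simp add: vec_eq_iff laplacian_def left_diff_distrib right_diff_distrib sum_subtractf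
        if_distrib[of "\<lambda>u. u * _"] sum_distrib_right cong: if_cong)
qed

lemma ker_transpose_equilibrium:
  assumes E: "simple_graph E" and \<sigma>: "\<sigma> \<in> ker_transpose E (DR_matrix p)"
  shows "laplacian (edge_weight E \<sigma>) (\<lambda>v. p v $ Inl i) = (\<lambda>_. 0)"
proof
  fix v
  let ?R = "rigidity_matrix (first_coords p)"
  have "(\<Sum>e\<in>E. DR_matrix p e (Inl (v, i)) * \<sigma> e) = 0"
    using \<sigma> by (simp add: ker_transpose_def)
  also have "(\<Sum>e\<in>E. DR_matrix p e (Inl (v, i)) * \<sigma> e) = (\<Sum>e\<in>E. if v \<in> e then ?R e (v, i) * \<sigma> e else 0)"
    by (intro sum.cong) (auto simp: DR_matrix_def rigidity_matrix_def)
  also have "\<dots> = (\<Sum>u\<in>UNIV. if {v, u} \<in> E then ?R {v, u} (v, i) * \<sigma> {v, u} else 0)"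
    by (rule sum_neighbours[OF E, symmetric])
  also have "\<dots> = laplacian (edge_weight E \<sigma>) (\<lambda>v. p v $ Inl i) v"
    unfolding laplacian_def
  proof (rule sum.cong)
    fix u
    show "(if {v, u} \<in> E then ?R {v, u} (v, i) * \<sigma> {v, u} else 0) = edge_weight E \<sigma> v u * (p v $ Inl i - p u $ Inl i)"
      using simple_graph_no_loop[OF E, of v]
      by (cases "v = u") (auto simp: edge_weight_def rigidity_matrix_entries(1) first_coords_def)
  qed simp
  finally show "laplacian (edge_weight E \<sigma>) (\<lambda>v. p v $ Inl i) v = 0" .
qed

lemma ker_transpose_orthogonal:
  fixes E :: "'v::finite set set"
  assumes E: "simple_graph E" and \<sigma>: "\<sigma> \<in> ker_transpose E (DR_matrix p)"
  shows "(\<Sum>v\<in>UNIV. \<Sum>u\<in>UNIV. edge_weight E \<sigma> v u * (p v $ Inr j - p u $ Inr j)\<^sup>2) = 0"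
proof -
  let ?h = "\<lambda>e. edge_map (\<lambda>v. p v $ Inr j) e * \<sigma> e"
  have "(\<Sum>v\<in>UNIV. \<Sum>u\<in>UNIV. edge_weight E \<sigma> v u * (p v $ Inr j - p u $ Inr j)\<^sup>2) =
      (\<Sum>v\<in>UNIV. \<Sum>u\<in>UNIV. if {v, u} \<in> E then ?h {v, u} else 0)"
    by (intro sum.cong refl) (simp add: edge_weight_def edge_map_entries)
  also have "\<dots> = 2 * (\<Sum>e\<in>E. ?h e)" by (rule sum_ordered_edges[OF E])
  also have "(\<Sum>e\<in>E. ?h e) = (\<Sum>e\<in>E. DR_matrix p e (Inr j) * \<sigma> e)"
    by (simp add: DR_matrix_def)
  also have "\<dots> = 0" using \<sigma> by (simp add: ker_transpose_def)
  finally show ?thesis by simp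
qed

lemma norm_diff_sum_type:
  fixes a b :: "real^('m::finite + 'k::finite)"
  shows "(norm (a - b))\<^sup>2 = (\<Sum>i\<in>UNIV. (a $ Inl i - b $ Inl i)\<^sup>2) + (\<Sum>j\<in>UNIV. (a $ Inr j - b $ Inr j)\<^sup>2)"
proof -
  have "(norm (a - b))\<^sup>2 = (\<Sum>i\<in>UNIV <+> UNIV. (a $ i - b $ i)\<^sup>2)"
    unfolding power2_norm_eq_inner inner_vec_def by (simp add: power2_eq_square)
  also have "\<dots> = (\<Sum>i\<in>UNIV. (a $ Inl i - b $ Inl i)\<^sup>2) + (\<Sum>j\<in>UNIV. (a $ Inr j - b $ Inr j)\<^sup>2)"
    by (simp add: sum.Plus comp_def del: UNIV_Plus_UNIV)
  finally show ?thesis .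
qed

text \<open>Equilibrium at \<open>v\<close> is an affine dependency among \<open>v\<close> and its
  at most \<open>CARD('m)\<close> neighbours, and so few generic points are affinely
  independent.\<close>

lemma equilibrium_degree:
  fixes x :: "'v::finite \<times> ('m::finite + 'k::finite) \<Rightarrow> real"
  assumes x: "alg_independent_rat x"
    and s: "\<And>u. s v u \<noteq> 0 \<Longrightarrow> u \<in> N"
    and stress: "\<And>i. laplacian s (\<lambda>v. x (v, Inl i)) v = 0"
    and card: "card N \<le> CARD('m)" and v: "v \<notin> N"
  shows "s v u = 0"
proof (cases "u \<in> N")
  case True
  define c where "c u = (if u = v then \<Sum>w\<in>N. s v w else - s v u)" for u
  have c: "(\<Sum>u\<in>insert v N. c u * g u) = (\<Sum>u\<in>N. s v u * (g v - g u))" for g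
  proof -
    have "(\<Sum>u\<in>N. c u * g u) = (\<Sum>u\<in>N. - (s v u * g u))"
      using v by (intro sum.cong) (auto simp: c_def)
    then show ?thesis
      using v by (simp add: c_def right_diff_distrib sum_subtractf sum_distrib_right sum_negf)
  qed
  have "c u = 0"
  proof (rule generic_points_affinely_independent[OF x])
    show "card (insert v N) \<le> card (range (Inl :: 'm \<Rightarrow> 'm + 'k)) + 1"
      using card v by (simp add: card_image)
    show "(\<Sum>u\<in>insert v N. c u) = 0"
      using c[of "\<lambda>_. 1"] by simp
    show "u \<in> insert v N" using True by simp
    fix k assume "k \<in> range (Inl :: 'm \<Rightarrow> 'm + 'k)"
    then obtain i where k: "k = Inl i" by blast
    have "(\<Sum>u\<in>N. s v u * (x (v, k) - x (u, k))) = (\<Sum>u\<in>UNIV. s v u * (x (v, k) - x (u, k)))"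
      using s by (intro sum.mono_neutral_left) auto
    then show "(\<Sum>u\<in>insert v N. c u * x (u, k)) = 0"
      using stress[of i] by (simp add: c laplacian_def k)
  qed
  with True v show ?thesis by (auto simp: c_def split: if_splits)
qed (use s in blast)

theorem theorem5p6:
  fixes d k :: nat
    and E :: "'v::finite set set"
    and p :: "'v \<Rightarrow> real^('m::finite + 'k::finite)"
  assumes "1 \<le> k" and "k < d"
    and "CARD('m) = d - k" and "CARD('k) = k"
    and "simple_graph E"
    and "generic p"
    and "CARD('v) = d - k + 1 \<longrightarrow> complete_graph E"
    and "\<exists>\<sigma>\<in>ker_transpose E (DR_matrix p).
           int (rank (stress_matrix E \<sigma>)) = int CARD('v) - int d + int k - 1"
  shows "globally_dk_rigid E p"
  unfolding globally_dk_rigid_def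
proof (intro allI impI)
  fix q assume equiv: "dk_equivalent E p q"
  define x where "x = (\<lambda>(v, i). p v $ i)"
  have x: "alg_independent_rat x"
    using assms(6) by (simp add: generic_def x_def)
  obtain \<sigma> where \<sigma>: "\<sigma> \<in> ker_transpose E (DR_matrix p)"
    and rank: "rank (stress_matrix E \<sigma>) + CARD('m) + 1 = CARD('v)"
    using assms(2,3,8) by fastforce
  note E = \<open>simple_graph E\<close>
  define s where "s = edge_weight E \<sigma>"
  have s: "s v u = s u v" for v u
    unfolding s_def by (rule edge_weight_commute)
  have sE: "{v, u} \<in> E" if "s v u \<noteq> 0" for v u
    using that by (auto simp: s_def edge_weight_def split: if_splits)
  have stress: "laplacian s (\<lambda>v. x (v, Inl i)) = (\<lambda>_. 0)" for i
    using ker_transpose_equilibrium[OF E \<sigma>] by (simp add: s_def x_def)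
  have ortho: "(\<Sum>v\<in>UNIV. \<Sum>u\<in>UNIV. s v u * (x (v, Inr j) - x (u, Inr j))\<^sup>2) = 0" for j
    using ker_transpose_orthogonal[OF E \<sigma>] by (simp add: s_def x_def)
  note kernel = laplacian_kernel[OF x stress_matrix_mult[OF E, of \<sigma>] rank, folded s_def, OF stress]

  show "congruent_frameworks p q"
  proof (cases "CARD('v) = d - k + 1")
    case True
    \<comment> \<open>Here the zero stress may be the one given, so rigidity comes from
      completeness: every distance is an edge length.\<close>
    then have "complete_graph E" using assms(7) by simp
    show ?thesis
      unfolding congruent_frameworks_def
    proof (intro allI)
      fix v w
      show "norm (q v - q w) = norm (p v - p w)"
        using \<open>complete_graph E\<close> equiv
        by (cases "v = w") (auto simp: complete_graph_def dk_equivalent_def)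
    qed
  next
    case False
    then have big: "CARD('m) + 1 < CARD('v)" using rank assms(3) by linarith
    have card_Inl: "card (range (Inl :: 'm \<Rightarrow> 'm + 'k)) = CARD('m)"
      by (simp add: card_image)

    obtain \<alpha> where \<alpha>: "\<And>j. \<alpha> j \<noteq> 0" "\<And>j v. p v $ Inr j = \<alpha> j * q v $ Inr j"
      using equiv unfolding dk_equivalent_def by metis
    \<comment> \<open>The relative change of the squared differences in the last coordinate
      \<open>j\<close> when passing from \<open>p\<close> to \<open>q\<close>.\<close>
    define \<gamma> where "\<gamma> j = inverse ((\<alpha> j)\<^sup>2) - 1" for j
    have last: "(q v $ Inr j - q u $ Inr j)\<^sup>2 = (1 + \<gamma> j) * (x (v, Inr j) - x (u, Inr j))\<^sup>2" for v u j
    proof -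
      have "x (v, Inr j) - x (u, Inr j) = \<alpha> j * (q v $ Inr j - q u $ Inr j)"
        by (simp add: x_def \<alpha>(2) right_diff_distrib)
      then show ?thesis using \<alpha>(1)[of j] by (simp add: \<gamma>_def power_mult_distrib)
    qed
    have edge: "(\<Sum>i\<in>UNIV. (q v $ Inl i - q u $ Inl i)\<^sup>2) + (\<Sum>j\<in>UNIV. \<gamma> j * (x (v, Inr j) - x (u, Inr j))\<^sup>2) =
        (\<Sum>i\<in>UNIV. (x (v, Inl i) - x (u, Inl i))\<^sup>2)" if "{v, u} \<in> E" for v u
    proof -
      have "(norm (p v - p u))\<^sup>2 = (norm (q v - q u))\<^sup>2"
        using equiv that by (simp add: dk_equivalent_def)
      then show ?thesis
        unfolding norm_diff_sum_type last by (simp add: x_def distrib_right sum.distrib)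
    qed
    have "\<exists>a b. \<forall>v. q v $ Inl i = a + (\<Sum>j\<in>UNIV. b j * x (v, Inl j))" for i
    proof -
      have "laplacian s (\<lambda>v. q v $ Inl i) = (\<lambda>_. 0)"
        using laplacian_of_equivalent[OF x s stress ortho, of "\<lambda>v i. q v $ Inl i" \<gamma>] edge sE by blast
      from kernel[OF this] show ?thesis .
    qed
    then obtain a B where B: "\<And>i v. q v $ Inl i = a i + (\<Sum>j\<in>UNIV. B i j * x (v, Inl j))"
      by metis
    \<comment> \<open>\<open>Q\<close> is the Gram matrix of the columns of \<open>B\<close> minus
      the identity: it measures how far the linear part of the affine map is from an
      isometry.\<close>
    define Q where "Q j l = (\<Sum>i\<in>UNIV. B i j * B i l) - (if j = l then 1 else 0)" for j l
    have first: "(\<Sum>i\<in>UNIV. (q v $ Inl i - q u $ Inl i)\<^sup>2) = (\<Sum>i\<in>UNIV. (x (v, Inl i) - x (u, Inl i))\<^sup>2) +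
        (\<Sum>j\<in>UNIV. \<Sum>l\<in>UNIV. Q j l * ((x (v, Inl j) - x (u, Inl j)) * (x (v, Inl l) - x (u, Inl l))))" for v u
    proof -
      define y where "y j = x (v, Inl j) - x (u, Inl j)" for j
      have "q v $ Inl i - q u $ Inl i = (\<Sum>j\<in>UNIV. B i j * y j)" for i
        by (simp add: B y_def right_diff_distrib sum_subtractf)
      then have "(\<Sum>i\<in>UNIV. (q v $ Inl i - q u $ Inl i)\<^sup>2) = (\<Sum>i\<in>UNIV. \<Sum>j\<in>UNIV. \<Sum>l\<in>UNIV. B i j * B i l * (y j * y l))"
        by (simp add: power2_eq_square sum_product mult_ac)
      also have "\<dots> = (\<Sum>j\<in>UNIV. \<Sum>i\<in>UNIV. \<Sum>l\<in>UNIV. B i j * B i l * (y j * y l))"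
        by (rule sum.swap)
      also have "\<dots> = (\<Sum>j\<in>UNIV. \<Sum>l\<in>UNIV. \<Sum>i\<in>UNIV. B i j * B i l * (y j * y l))"
        by (intro sum.cong refl sum.swap)
      also have "\<dots> = (\<Sum>j\<in>UNIV. \<Sum>l\<in>UNIV. (if j = l then 1 else 0) * (y j * y l) + Q j l * (y j * y l))"
        by (simp add: Q_def sum_distrib_right left_diff_distrib)
      also have "\<dots> = (\<Sum>j\<in>UNIV. (y j)\<^sup>2) + (\<Sum>j\<in>UNIV. \<Sum>l\<in>UNIV. Q j l * (y j * y l))"
        by (simp add: sum.distrib power2_eq_square if_distrib[of "\<lambda>u. u * _"] cong: if_cong)
      finally show ?thesis by (simp add: y_def)
    qed

    \<comment> \<open>Otherwise the last coordinate \<open>j\<close> lies in the kernel of the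
      Laplacian and is an affine function of the first ones, impossible for more than
      \<open>CARD('m) + 1\<close> generic points.\<close>
    have \<gamma>: "\<gamma> j = 0" for j
    proof (rule ccontr)
      assume "\<gamma> j \<noteq> 0"
      have "(\<Sum>i\<in>UNIV. \<Sum>l\<in>UNIV. Q i l * ((x (v, Inl i) - x (u, Inl i)) * (x (v, Inl l) - x (u, Inl l)))) +
          (\<Sum>j\<in>UNIV. \<gamma> j * (x (v, Inr j) - x (u, Inr j))\<^sup>2) = 0" if "s v u \<noteq> 0" for v u
        using edge[OF sE[OF that]] first[of v u] by linarith
      from quadratic_relation_coeff[OF x s stress ortho this, of j] \<open>\<gamma> j \<noteq> 0\<close>
      have "laplacian s (\<lambda>v. x (v, Inr j)) = (\<lambda>_. 0)" by auto
      then obtain c b where cb: "\<And>v. x (v, Inr j) = c + (\<Sum>i\<in>UNIV. b i * x (v, Inl i))"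
        using kernel by blast
      let ?C = "insert (Inr j) (range Inl) :: ('m + 'k) set"
      let ?b = "\<lambda>k. case k of Inl i \<Rightarrow> b i | Inr _ \<Rightarrow> - 1"
      have "card ?C < card (UNIV :: 'v set)"
        using big by (subst card_insert_disjoint) (auto simp: card_Inl)
      moreover have "c + (\<Sum>k\<in>?C. ?b k * x (v, k)) = 0" for v
        using cb[of v] by (subst sum.insert) (auto simp: sum.reindex)
      ultimately have "?b (Inr j) = 0"
        by (rule generic_affine_functions_independent(2)[OF x, where i = "Inr j"]) auto
      then show False by simp
    qed

    \<comment> \<open>At a vertex of smaller degree the stress vanishes, so its indicator function
      lies in the kernel. It is then affine in the first coordinates and zero at the more than
      \<open>CARD('m)\<close> other vertices, hence zero.\<close>
    have degree: "CARD('m) \<le> card {u. {v, u} \<in> E}" for v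
    proof (rule ccontr)
      assume "\<not> CARD('m) \<le> card {u. {v, u} \<in> E}"
      then have "card {u. {v, u} \<in> E} \<le> CARD('m)" by simp
      then have zero: "s v u = 0" for u
        by (rule equilibrium_degree[OF x, rotated 2])
          (use simple_graph_no_loop[OF E, of v] in \<open>simp_all add: sE stress\<close>)
      have "laplacian s (\<lambda>u. if u = v then 1 else 0) = (\<lambda>_. 0)"
      proof
        fix w
        show "laplacian s (\<lambda>u. if u = v then 1 else 0) w = 0"
          unfolding laplacian_def
          by (rule sum.neutral) (use zero s[of _ v] in auto)
      qed
      then obtain c b where cb: "\<And>u. (if u = v then 1 else 0) = c + (\<Sum>i\<in>UNIV. b i * x (u, Inl i))"
        using kernel by blast
      have card: "card (range (Inl :: 'm \<Rightarrow> 'm + 'k)) < card (UNIV - {v})"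
        using big by (simp add: card_Inl)
      have eq: "c + (\<Sum>k\<in>range Inl. b (projl k) * x (u, k)) = 0" if "u \<in> UNIV - {v}" for u
        using cb[of u] that by (simp add: sum.reindex)
      have "b i = 0" for i
        using generic_affine_functions_independent(2)[OF x card eq, of "Inl i"] by simp
      moreover have "c = 0"
        by (rule generic_affine_functions_independent(1)[OF x card eq])
      ultimately show False using cb[of v] by simp
    qed

    have "Q i j = 0" for i j
    proof -
      \<comment> \<open>\<open>Q\<close> is reindexed by the coordinates of \<open>x\<close>; only
        the entries of \<open>Q'\<close> on \<open>range Inl\<close> carry meaning.\<close>
      define Q' where "Q' k l = Q (projl k) (projl l)" for k l :: "'m + 'k"
      have "Q' (Inl i) (Inl j) = 0"
      proof (rule generic_edge_directions_on_no_quadric[OF x, where adj = "\<lambda>v u. {v, u} \<in> E" and W = UNIV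
            and C = "range Inl" and Q = Q'])
        show "{v, v} \<notin> E" for v by (rule simple_graph_no_loop[OF E])
        show "card (range (Inl :: 'm \<Rightarrow> 'm + 'k)) \<le> card {u \<in> UNIV. {v, u} \<in> E}" for v
          using degree[of v] by (simp add: card_Inl)
        show "Q' k l = Q' l k" for k l
          by (simp add: Q'_def Q_def mult.commute)
        show "(\<Sum>k\<in>range Inl. \<Sum>l\<in>range Inl. Q' k l * ((x (v, k) - x (u, k)) * (x (v, l) - x (u, l)))) = 0"
          if "{v, u} \<in> E" for v u
          using edge[OF that] first[of v u] by (simp add: \<gamma> Q'_def sum.reindex)
      qed auto
      then show ?thesis by (simp add: Q'_def)
    qed
    then have "(norm (q v - q w))\<^sup>2 = (norm (p v - p w))\<^sup>2" for v w
      unfolding norm_diff_sum_type last first by (simp add: \<gamma>) (simp add: x_def)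
    then show ?thesis
      by (simp add: congruent_frameworks_def)
  qed
qed

end
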